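(* In general dimension (i.e. dimension $4n\ge12$) there are at most $167$ different almost hyper-Hermitian types. That is, for each $n\ge3$, as $(M,\langle\cdot,\cdot\rangle,I,J,K)$ ranges over all almost hyper-Hermitian manifolds of dimension $4n$, the unordered triple (multiset) of Gray-Hervella types of the three almost Hermitian structures $I$, $J$, $K$ takes at most $167$ different values.
   Context: An almost hyper-Hermitian manifold is a smooth $4n$-manifold $M$ with a Riemannian metric $\langle\cdot,\cdot\rangle$ and global endomorphism fields $I,J,K$ of $TM$ satisfying $I^2=J^2=-1$, $K=IJ=-JI$ and $\langle AX,AY\rangle=\langle X,Y\rangle$ for $A=I,J,K$. Put $\omega_A(X,Y)=\langle X,AY\rangle$, let $\nabla$ be the Levi-Civita connection, and regard $\nabla\omega_A$ as the $(0,3)$-tensor $(X,Y,Z)\mapsto(\nabla_X\omega_A)(Y,Z)$. For $A\in\{I,J,K\}$, $\nabla\omega_A$ takes values in $\mathcal W^A=\{b\in T^*M\otimes\Lambda^2T^*M: b(X,AY,AZ)=-b(X,Y,Z)\}$, and $\mathcal W^A=\mathcal W_1\oplus\mathcal W_2\oplus\mathcal W_3\oplus\mathcal W_4$ (orthogonal), where, with $\{e_i\}$ an orthonormal basis, $\mathcal W_1$: $b(X,X,Z)=0$ for all $X,Z$; $\mathcal W_2$: $b(X,Y,Z)+b(Y,Z,X)+b(Z,X,Y)=0$; $\mathcal W_3$: $b(AX,AY,Z)=b(X,Y,Z)$ and $\sum_i b(e_i,e_i,Z)=0$; $\mathcal W_4$: $b(X,Y,Z)=\langle X,Y\rangle\beta(Z)-\langle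 X,Z\rangle\beta(Y)-\langle X,AY\rangle\beta(AZ)+\langle X,AZ\rangle\beta(AY)$ for some one-form $\beta$. The Gray-Hervella type of $A$ is the set of indices $i\in\{1,2,3,4\}$ such that the $\mathcal W_i$-component of $\nabla\omega_A$ is not identically zero on $M$ (16 possible types, hence $816$ potential unordered triples). *)

theory Defs
  imports "HOL-Analysis.Analysis" "HOL-Library.Multiset"
begin

section \<open>Smooth manifolds\<close>

text \<open>Directional derivatives suffice for \<open>C\<^sup>k\<close>, since \<open>S\<close> is open and the
  domain finite-dimensional in every use.\<close>

primrec Ck_on :: "nat \<Rightarrow> ('b::euclidean_space \<Rightarrow> 'c::real_normed_vector) \<Rightarrow> 'b set \<Rightarrow> bool" where
  "Ck_on 0 f S \<longleftrightarrow> continuous_on S f"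
| "Ck_on (Suc k) f S \<longleftrightarrow>
     (\<forall>x\<in>S. f differentiable (at x)) \<and>
     (\<forall>v. Ck_on k (\<lambda>x. frechet_derivative f (at x) v) S)"

definition smooth_on :: "('b::euclidean_space \<Rightarrow> 'c::real_normed_vector) \<Rightarrow> 'b set \<Rightarrow> bool" where
  "smooth_on f S \<longleftrightarrow> (\<forall>k. Ck_on k f S)"

text \<open>A chart is a pair \<open>(U, \<phi>)\<close>; the values of \<open>\<phi>\<close> outside \<open>U\<close> are irrelevant.\<close>

type_synonym ('a, 'b) chart = "'a set \<times> ('a \<Rightarrow> 'b)"

definition codom :: "('a, 'b) chart \<Rightarrow> 'b set" where
  "codom c = snd c ` fst c"

definition transition :: "('a, 'b) chart \<Rightarrow> ('a, 'b) chart \<Rightarrow> 'b \<Rightarrow> 'b" where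
  "transition c c' = snd c' \<circ> inv_into (fst c) (snd c)"

definition is_chart :: "'a topology \<Rightarrow> ('a, 'b::euclidean_space) chart \<Rightarrow> bool" where
  "is_chart M c \<longleftrightarrow>
     openin M (fst c) \<and> open (codom c) \<and>
     homeomorphic_map (subtopology M (fst c)) (top_of_set (codom c)) (snd c)"

text \<open>The dimension of the manifold is \<open>DIM('b)\<close>.\<close>

definition smooth_manifold :: "'a topology \<Rightarrow> ('a, 'b::euclidean_space) chart set \<Rightarrow> bool" where
  "smooth_manifold M \<A> \<longleftrightarrow>
     Hausdorff_space M \<and> second_countable M \<and>
     (\<forall>c\<in>\<A>. is_chart M c) \<and>
     (\<Union>c\<in>\<A>. fst c) = topspace M \<and>
     (\<forall>c\<in>\<A>. \<forall>c'\<in>\<A>. smooth_on (transition c c') (snd c ` (fst c \<inter> fst c')))"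

section \<open>Tensor fields\<close>

text \<open>A tensor field is given by its local expressions: for every chart \<open>c\<close> of the atlas and
  every \<open>x \<in> codom c\<close>, a tensor on the coordinate space \<open>'b\<close> (the tangent space in the
  coordinates of \<open>c\<close>). The expressions are smooth in \<open>x\<close> and are related on overlaps by the
  differential \<open>D\<close> of the coordinate change. Values at other \<open>c\<close>, \<open>x\<close> are irrelevant.\<close>

type_synonym ('a, 'b) metric_field = "('a, 'b) chart \<Rightarrow> 'b \<Rightarrow> 'b \<Rightarrow> 'b \<Rightarrow> real"
type_synonym ('a, 'b) endo_field = "('a, 'b) chart \<Rightarrow> 'b \<Rightarrow> 'b \<Rightarrow> 'b"

definition riemannian_metric ::
  "('a, 'b::euclidean_space) chart set \<Rightarrow> ('a, 'b) metric_field \<Rightarrow> bool" where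
  "riemannian_metric \<A> g \<longleftrightarrow>
     (\<forall>c\<in>\<A>. \<forall>x\<in>codom c.
        bilinear (g c x) \<and> (\<forall>u v. g c x u v = g c x v u) \<and> (\<forall>u. u \<noteq> 0 \<longrightarrow> g c x u u > 0)) \<and>
     (\<forall>c\<in>\<A>. \<forall>u v. smooth_on (\<lambda>x. g c x u v) (codom c)) \<and>
     (\<forall>c\<in>\<A>. \<forall>c'\<in>\<A>. \<forall>p \<in> fst c \<inter> fst c'. \<forall>u v.
        let D = frechet_derivative (transition c c') (at (snd c p))
        in g c (snd c p) u v = g c' (snd c' p) (D u) (D v))"

definition endomorphism_field ::
  "('a, 'b::euclidean_space) chart set \<Rightarrow> ('a, 'b) endo_field \<Rightarrow> bool" where
  "endomorphism_field \<A> A \<longleftrightarrow>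
     (\<forall>c\<in>\<A>. \<forall>x\<in>codom c. linear (A c x)) \<and>
     (\<forall>c\<in>\<A>. \<forall>u. smooth_on (\<lambda>x. A c x u) (codom c)) \<and>
     (\<forall>c\<in>\<A>. \<forall>c'\<in>\<A>. \<forall>p \<in> fst c \<inter> fst c'. \<forall>u.
        let D = frechet_derivative (transition c c') (at (snd c p))
        in D (A c (snd c p) u) = A c' (snd c' p) (D u))"

definition almost_hyper_hermitian ::
  "'a topology \<Rightarrow> ('a, 'b::euclidean_space) chart set \<Rightarrow> ('a, 'b) metric_field \<Rightarrow>
   ('a, 'b) endo_field \<Rightarrow> ('a, 'b) endo_field \<Rightarrow> ('a, 'b) endo_field \<Rightarrow> bool" where
  "almost_hyper_hermitian M \<A> g I J K \<longleftrightarrow>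
     smooth_manifold M \<A> \<and> riemannian_metric \<A> g \<and>
     endomorphism_field \<A> I \<and> endomorphism_field \<A> J \<and> endomorphism_field \<A> K \<and>
     (\<forall>c\<in>\<A>. \<forall>x\<in>codom c. \<forall>u.
        I c x (I c x u) = - u \<and> J c x (J c x u) = - u \<and>
        K c x u = I c x (J c x u) \<and> K c x u = - J c x (I c x u)) \<and>
     (\<forall>A\<in>{I, J, K}. \<forall>c\<in>\<A>. \<forall>x\<in>codom c. \<forall>u v. g c x (A c x u) (A c x v) = g c x u v)"

section \<open>The covariant derivative of the fundamental forms\<close>

text \<open>In a chart the Levi-Civita connection is \<open>\<nabla>\<^sub>X Y = D\<^sub>X Y + \<Gamma>(X, Y)\<close>. It is the unique torsion-free
  metric connection, i.e. \<open>\<Gamma>(X, Y) = \<Gamma>(Y, X)\<close> and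
  \<open>D\<^sub>X (g(Y, Z)) = g(\<nabla>\<^sub>X Y, Z) + g(Y, \<nabla>\<^sub>X Z)\<close>, the latter for the constant fields \<open>Y\<close>, \<open>Z\<close>.\<close>

definition levi_civita ::
  "('b \<Rightarrow> 'b \<Rightarrow> 'b \<Rightarrow> real) \<Rightarrow> 'b \<Rightarrow> 'b \<Rightarrow> 'b::euclidean_space \<Rightarrow> 'b" where
  "levi_civita g x = (THE \<Gamma>.
     bilinear \<Gamma> \<and> (\<forall>X Y. \<Gamma> X Y = \<Gamma> Y X) \<and>
     (\<forall>X Y Z. frechet_derivative (\<lambda>y. g y Y Z) (at x) X = g x (\<Gamma> X Y) Z + g x Y (\<Gamma> X Z)))"

definition nabla_omega ::
  "('b \<Rightarrow> 'b \<Rightarrow> 'b \<Rightarrow> real) \<Rightarrow> ('b \<Rightarrow> 'b \<Rightarrow> 'b) \<Rightarrow> 'b \<Rightarrow> 'b \<Rightarrow> 'b \<Rightarrow> 'b::euclidean_space \<Rightarrow> real" where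
  "nabla_omega g A x X Y Z =
     (let \<omega> = (\<lambda>y U V. g y U (A y V)); \<Gamma> = levi_civita g x
      in frechet_derivative (\<lambda>y. \<omega> y Y Z) (at x) X - \<omega> x (\<Gamma> X Y) Z - \<omega> x Y (\<Gamma> X Z))"

section \<open>Gray--Hervella types\<close>

text \<open>Below, \<open>h\<close> is an inner product on \<open>'b\<close> and \<open>A\<close> an \<open>h\<close>-orthogonal complex structure.\<close>

definition GH_space ::
  "('b::euclidean_space \<Rightarrow> 'b) \<Rightarrow> ('b \<Rightarrow> 'b \<Rightarrow> 'b \<Rightarrow> real) set" where
  "GH_space A = {b.
     (\<forall>Y Z. linear (\<lambda>X. b X Y Z)) \<and> (\<forall>X. bilinear (b X)) \<and>
     (\<forall>X Y Z. b X Y Z = - b X Z Y) \<and>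
     (\<forall>X Y Z. b X (A Y) (A Z) = - b X Y Z)}"

definition orthonormal_basis_wrt :: "('b::euclidean_space \<Rightarrow> 'b \<Rightarrow> real) \<Rightarrow> 'b set \<Rightarrow> bool" where
  "orthonormal_basis_wrt h E \<longleftrightarrow>
     finite E \<and> span E = UNIV \<and> (\<forall>e\<in>E. \<forall>f\<in>E. h e f = (if e = f then 1 else 0))"

definition GH_class ::
  "('b::euclidean_space \<Rightarrow> 'b \<Rightarrow> real) \<Rightarrow> ('b \<Rightarrow> 'b) \<Rightarrow> nat \<Rightarrow> ('b \<Rightarrow> 'b \<Rightarrow> 'b \<Rightarrow> real) set" where
  "GH_class h A i = {b \<in> GH_space A.
     (i = 1 \<and> (\<forall>X Z. b X X Z = 0)) \<or>
     (i = 2 \<and> (\<forall>X Y Z. b X Y Z + b Y Z X + b Z X Y = 0)) \<or>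
     (i = 3 \<and> (\<forall>X Y Z. b (A X) (A Y) Z = b X Y Z) \<and>
        (\<forall>E Z. orthonormal_basis_wrt h E \<longrightarrow> (\<Sum>e\<in>E. b e e Z) = 0)) \<or>
     (i = 4 \<and> (\<exists>\<beta>. linear \<beta> \<and> (\<forall>X Y Z.
        b X Y Z = h X Y * \<beta> Z - h X Z * \<beta> Y - h X (A Y) * \<beta> (A Z) + h X (A Z) * \<beta> (A Y))))}"

text \<open>The \<open>i\<close>-th component of \<open>b\<close> in the direct sum of the four classes.\<close>

definition GH_component ::
  "('b::euclidean_space \<Rightarrow> 'b \<Rightarrow> real) \<Rightarrow> ('b \<Rightarrow> 'b) \<Rightarrow> nat \<Rightarrow>
   ('b \<Rightarrow> 'b \<Rightarrow> 'b \<Rightarrow> real) \<Rightarrow> ('b \<Rightarrow> 'b \<Rightarrow> 'b \<Rightarrow> real)" where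
  "GH_component h A i b = (THE w. \<exists>d. (\<forall>j\<in>{1..4}. d j \<in> GH_class h A j) \<and>
     (\<forall>X Y Z. b X Y Z = (\<Sum>j=1..4. d j X Y Z)) \<and> w = d i)"

definition GH_type ::
  "('a, 'b::euclidean_space) chart set \<Rightarrow> ('a, 'b) metric_field \<Rightarrow> ('a, 'b) endo_field \<Rightarrow> nat set" where
  "GH_type \<A> g A = {i \<in> {1..4}. \<exists>c\<in>\<A>. \<exists>x\<in>codom c. \<exists>X Y Z.
     GH_component (g c x) (A c x) i (nabla_omega (g c) (A c) x) X Y Z \<noteq> 0}"

end

(*
  Write nabla omega_I = beta(K., .) - gamma(J., .), and cyclically for J and K with a third
  tensor alpha, where alpha, beta, gamma take values in the symmetric bilinear forms invariant
  under I, J, K. For a tensor u of this kind and A = I, J, K let u.A be (X, Y, Z) |-> u(AX, Y, Z).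
  The classes W1, W2 of I depend only on u_I = gamma + beta.I, and W3, W4 only on
  v_I = gamma - beta.I; expressed in u and v, the four conditions are independent of I, J, K and
  stable under sums and under u |-> u.A. In each of the four triples (u_I, u_J, u_K),
  (u_I, v_J, v_K), (v_I, u_J, v_K), (v_I, v_J, u_K) every member is a combination of right
  translates of the other two. A tensor that satisfies the condition of W3 is determined by a
  one-form, which traces detect. This gives nine implications between the vanishing of the
  components, invariant under permutations of I, J, K, and exactly 167 multisets of types satisfy
  them.
*)

theory Submission
  imports Defs
begin

section \<open>Inner products\<close>

text \<open>Write T = E (x) H. The last two arguments of the tensors in question see only Lambda^2
  E, so \<open>u.A\<close> moves just the H-factor of X, whereas the four conditions concern E (x)
  Lambda^2 E. That is why they ignore the choice of I, J, K and survive translation. W1 and W2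
  separate Lambda^3 E from the mixed part; W3 and W4 concern the copies of E. In dimension above 4
  there are two such copies, one in Lambda^3 E and one in the mixed part, and the copy singled out
  by W3 is a diagonal one: it lies in neither part and not in the kernel of the trace. This
  position, measured by two traces, produces every interaction between the indices 1, 2 and the
  indices 3, 4. The obstacle is that u_I and v_I are independent of each other, so a single
  structure satisfies no relation at all; relations arise only by passing through the tensors of the
  other two. They all have the form "some components vanish, hence another one vanishes", and this
  form lets a pointwise argument settle types that are defined over the whole manifold.\<close>

locale inner_form =
  fixes h :: "'b::euclidean_space \<Rightarrow> 'b \<Rightarrow> real"
  assumes bil: "bilinear h"
    and sym: "h x y = h y x"
    and pos: "x \<noteq> 0 \<Longrightarrow> h x x > 0"
begin

lemmas h_simps [simp] = bilinear_ladd[OF bil] bilinear_radd[OF bil] bilinear_lmul[OF bil]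
  bilinear_rmul[OF bil] bilinear_lneg[OF bil] bilinear_rneg[OF bil] bilinear_lsub[OF bil]
  bilinear_rsub[OF bil] bilinear_lzero[OF bil] bilinear_rzero[OF bil]

lemma h_sum_left: "h (\<Sum>i\<in>S. f i) y = (\<Sum>i\<in>S. h (f i) y)"
  using bil linear_sum[of "\<lambda>x. h x y" f S] by (simp add: bilinear_def)

lemma h_eq_zero_iff [simp]: "h x x = 0 \<longleftrightarrow> x = 0"
  using pos[of x] by (cases "x = 0") auto

lemma h_nondegenerate: "(\<And>z. h x z = h y z) \<Longrightarrow> x = y"
  using h_eq_zero_iff[of "x - y"] by simp

lemma orthonormal_independent:
  assumes "finite E" and E: "\<And>e f. e \<in> E \<Longrightarrow> f \<in> E \<Longrightarrow> h e f = (if e = f then 1 else 0)"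
  shows "independent E"
  unfolding dependent_finite[OF assms(1)]
proof safe
  fix u v assume v: "v \<in> E" "u v \<noteq> 0" and s: "(\<Sum>v\<in>E. u v *\<^sub>R v) = 0"
  have "0 = h (\<Sum>w\<in>E. u w *\<^sub>R w) v" by (simp add: s)
  also have "\<dots> = (\<Sum>w\<in>E. u w * (if w = v then 1 else 0))"
    unfolding h_sum_left using v by (intro sum.cong) (auto simp: E)
  also have "\<dots> = u v" using v assms(1) by (simp add: if_distrib cong: if_cong)
  finally show False using v by simp
qed

lemma orthonormal_expansion_span:
  assumes "finite E" and E: "\<And>e f. e \<in> E \<Longrightarrow> f \<in> E \<Longrightarrow> h e f = (if e = f then 1 else 0)"
    and "x \<in> span E"
  shows "(\<Sum>e\<in>E. h x e *\<^sub>R e) = x"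
  using assms(3)
proof (induction rule: span_induct_alt)
  case base then show ?case by simp
next
  case (step c y z)
  have "(\<Sum>e\<in>E. h y e *\<^sub>R e) = (\<Sum>e\<in>E. if e = y then e else 0)"
    using step by (intro sum.cong) (auto simp: E)
  then have "(\<Sum>e\<in>E. h y e *\<^sub>R e) = y"
    using step assms(1) by simp
  then show ?case using step
    by (simp add: scaleR_add_left sum.distrib flip: scaleR_scaleR scaleR_sum_right)
qed

text \<open>Independence bounds the size of an orthonormal set by \<open>DIM('b)\<close>, so a
  largest one exists; if its span missed \<open>x\<close>, the normalised difference of
  \<open>x\<close> and its projection would enlarge it.\<close>

lemma ex_orthonormal_basis: "\<exists>E. orthonormal_basis_wrt h E"
proof -
  define P where "P E \<longleftrightarrow> finite E \<and> (\<forall>e\<in>E. \<forall>f\<in>E. h e f = (if e = f then 1 else 0))" for E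
  have card: "card E \<le> DIM('b)" if "P E" for E
    using orthonormal_independent[of E] independent_bound[of E] that unfolding P_def by auto
  have "P {}" by (simp add: P_def)
  then obtain E where E: "P E" and max: "\<And>E'. P E' \<Longrightarrow> card E' \<le> card E"
    using ex_has_greatest_nat[of P "{}" card "Suc DIM('b)"] card by (meson le_imp_less_Suc)
  note fin = E[unfolded P_def, THEN conjunct1]
  note orth = E[unfolded P_def, THEN conjunct2, rule_format]
  have "x \<in> span E" for x
  proof (rule ccontr)
    assume x: "x \<notin> span E"
    define s where "s = (\<Sum>e\<in>E. h x e *\<^sub>R e)"
    have "s \<in> span E" unfolding s_def by (intro span_sum span_scale span_base)
    with x have "x - s \<noteq> 0" by auto
    define d where "d = x - s"
    have "h d d > 0" unfolding d_def by (rule pos) fact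
    define y where "y = (1 / sqrt (h d d)) *\<^sub>R d"
    have yy: "h y y = 1"
      using \<open>h d d > 0\<close> by (auto simp: y_def)
    have sf: "h s f = h x f" if "f \<in> E" for f
    proof -
      have "h s f = (\<Sum>e\<in>E. if e = f then h x e else 0)"
        unfolding s_def h_sum_left using that by (intro sum.cong) (auto simp: orth)
      also have "\<dots> = h x f" using that fin by simp
      finally show ?thesis .
    qed
    have yf: "h y f = 0" if "f \<in> E" for f
      using sf[OF that] by (simp add: y_def d_def)
    have fy: "h f y = 0" if "f \<in> E" for f
      using yf[OF that] sym by simp
    have "y \<notin> E" using yf yy by force
    have "P (insert y E)"
      using yy yf fy fin orth \<open>y \<notin> E\<close> by (auto simp: P_def)
    from max[OF this] show False using \<open>y \<notin> E\<close> fin by simp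
  qed
  then show ?thesis
    using fin orth by (auto simp: orthonormal_basis_wrt_def)
qed

definition onb where "onb = (SOME E. orthonormal_basis_wrt h E)"

lemma onb: "orthonormal_basis_wrt h onb"
  unfolding onb_def using someI_ex[OF ex_orthonormal_basis] .

lemma orthonormal_expansion:
  "orthonormal_basis_wrt h E \<Longrightarrow> (\<Sum>e\<in>E. h x e *\<^sub>R e) = x"
  unfolding orthonormal_basis_wrt_def by (intro orthonormal_expansion_span) auto

lemma orthonormal_contract:
  fixes \<phi> :: "'b \<Rightarrow> real"
  assumes E: "orthonormal_basis_wrt h E" and "linear \<phi>"
  shows "(\<Sum>e\<in>E. h x e * \<phi> e) = \<phi> x"
proof -
  have "\<phi> x = \<phi> (\<Sum>e\<in>E. h x e *\<^sub>R e)" by (simp add: orthonormal_expansion[OF E])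
  then show ?thesis using \<open>linear \<phi>\<close> by (simp add: linear_sum linear_scale)
qed

lemma orthonormal_card:
  assumes E: "orthonormal_basis_wrt h E"
  shows "card E = DIM('b)"
proof -
  have "independent E"
    using E orthonormal_independent unfolding orthonormal_basis_wrt_def by auto
  then show ?thesis
    using E basis_card_eq_dim[of E UNIV] unfolding orthonormal_basis_wrt_def by simp
qed

text \<open>Expanding the second argument in \<open>E'\<close> and contracting the first over
  \<open>E\<close> turns one trace into the other.\<close>

lemma trace_unique:
  fixes f :: "'b \<Rightarrow> 'b \<Rightarrow> real"
  assumes E: "orthonormal_basis_wrt h E" and E': "orthonormal_basis_wrt h E'" and f: "bilinear f"
  shows "(\<Sum>e\<in>E. f e e) = (\<Sum>e\<in>E'. f e e)"
proof -
  have l: "linear (f x)" "linear (\<lambda>y. f y x)" for x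
    using f by (auto simp: bilinear_def)
  have "(\<Sum>e\<in>E. f e e) = (\<Sum>e\<in>E. \<Sum>d\<in>E'. h e d * f e d)"
    by (simp add: orthonormal_contract[OF E'] l)
  also have "\<dots> = (\<Sum>d\<in>E'. \<Sum>e\<in>E. h d e * f e d)"
    by (subst sum.swap) (simp add: sym)
  also have "\<dots> = (\<Sum>d\<in>E'. f d d)"
    by (simp add: orthonormal_contract[OF E] l)
  finally show ?thesis .
qed

lemma trace_invariant:
  fixes f :: "'b \<Rightarrow> 'b \<Rightarrow> real"
  assumes E: "orthonormal_basis_wrt h E" and f: "bilinear f"
    and A: "linear A" "\<And>x y. h (A x) (A y) = h x y"
  shows "(\<Sum>e\<in>E. f (A e) (A e)) = (\<Sum>e\<in>E. f e e)"
proof -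
  have inj: "inj A"
    unfolding linear_injective_0[OF A(1)] using A(2) h_eq_zero_iff by metis
  have "surj A" using linear_inj_imp_surj[OF A(1) inj] .
  have "orthonormal_basis_wrt h (A ` E)"
    using E \<open>surj A\<close> inj unfolding orthonormal_basis_wrt_def
    by (auto simp: linear_span_image[OF A(1)] A(2) dest: injD)
  from trace_unique[OF this E f] show ?thesis
    by (simp add: sum.reindex[OF inj_on_subset[OF inj]])
qed

end

section \<open>The Gray--Hervella decomposition\<close>

locale hermitian_form = inner_form h for h :: "'b::euclidean_space \<Rightarrow> 'b \<Rightarrow> real" +
  fixes A :: "'b \<Rightarrow> 'b"
  assumes lin: "linear A"
    and sq [simp]: "A (A x) = - x"
    and orth: "h (A x) (A y) = h x y"
begin

lemmas A_simps [simp] = linear_neg[OF lin] linear_add[OF lin] linear_diff[OF lin]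
  linear_scale[OF lin] linear_0[OF lin]

lemma skew: "h (A x) y = - h x (A y)"
  using orth[of x "A y"] by simp

lemma h_A_self [simp]: "h x (A x) = 0"
  using skew[of x x] sym[of x "A x"] by linarith

definition w4 :: "('b \<Rightarrow> real) \<Rightarrow> 'b \<Rightarrow> 'b \<Rightarrow> 'b \<Rightarrow> real" where
  "w4 \<beta> X Y Z = h X Y * \<beta> Z - h X Z * \<beta> Y - h X (A Y) * \<beta> (A Z) + h X (A Z) * \<beta> (A Y)"

lemma GH_spaceD:
  assumes "b \<in> GH_space A"
  shows "linear (\<lambda>X. b X Y Z)" "bilinear (b X)" "b X Y Z = - b X Z Y"
    "b X (A Y) (A Z) = - b X Y Z" "b X (A Y) Z = b X Y (A Z)"
proof -
  show b: "linear (\<lambda>X. b X Y Z)" "bilinear (b X)" "b X Y Z = - b X Z Y"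
    "b X (A Y) (A Z) = - b X Y Z" for X Y Z
    using assms unfolding GH_space_def by blast+
  show "b X (A Y) Z = b X Y (A Z)"
    using b(4)[of X Y "A Z"] bilinear_rneg[OF b(2)[of X], of "A Y" Z] by simp
qed

lemma GH_space_bilinear12:
  assumes "b \<in> GH_space A"
  shows "bilinear (\<lambda>X Y. b X Y Z)"
  using GH_spaceD(1,2)[OF assms] by (simp add: bilinear_def)

lemma GH_space_simps:
  assumes "b \<in> GH_space A"
  shows "b (- X) Y Z = - b X Y Z" "b X (- Y) Z = - b X Y Z" "b X Y (- Z) = - b X Y Z"
    "b (X + X') Y Z = b X Y Z + b X' Y Z" "b X (Y + Y') Z = b X Y Z + b X Y' Z"
    "b X Y (Z + Z') = b X Y Z + b X Y Z'"
    "b (r *\<^sub>R X) Y Z = r * b X Y Z" "b X (r *\<^sub>R Y) Z = r * b X Y Z"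
    "b X Y (r *\<^sub>R Z) = r * b X Y Z"
proof -
  note l = GH_spaceD(1)[OF assms, of Y Z] and B = GH_spaceD(2)[OF assms, of X]
  show "b (- X) Y Z = - b X Y Z" "b (X + X') Y Z = b X Y Z + b X' Y Z"
    "b (r *\<^sub>R X) Y Z = r * b X Y Z"
    using linear_neg[OF l] linear_add[OF l] linear_scale[OF l] by simp_all
  show "b X (- Y) Z = - b X Y Z" "b X Y (- Z) = - b X Y Z"
    "b X (Y + Y') Z = b X Y Z + b X Y' Z" "b X Y (Z + Z') = b X Y Z + b X Y Z'"
    "b X (r *\<^sub>R Y) Z = r * b X Y Z" "b X Y (r *\<^sub>R Z) = r * b X Y Z"
    using bilinear_lneg[OF B] bilinear_rneg[OF B] bilinear_ladd[OF B] bilinear_radd[OF B]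
      bilinear_lmul[OF B] bilinear_rmul[OF B] by simp_all
qed

lemma GH_spaceI:
  assumes "\<And>X X' Y Z. b (X + X') Y Z = b X Y Z + b X' Y Z"
    and "\<And>r X Y Z. b (r *\<^sub>R X) Y Z = r * b X Y Z"
    and "\<And>X Y Z Z'. b X Y (Z + Z') = b X Y Z + b X Y Z'"
    and "\<And>r X Y Z. b X Y (r *\<^sub>R Z) = r * b X Y Z"
    and s: "\<And>X Y Z. b X Y Z = - b X Z Y"
    and "\<And>X Y Z. b X (A Y) (A Z) = - b X Y Z"
  shows "b \<in> GH_space A"
proof -
  have "linear (\<lambda>Y. b X Y Z)" for X Z
    unfolding s[of X _ Z] by (rule linearI) (simp_all add: assms(3,4))
  moreover have "linear (\<lambda>X. b X Y Z)" "linear (b X Y)" for X Y Z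
    by (rule linearI; simp add: assms(1-4))+
  ultimately show ?thesis
    unfolding GH_space_def bilinear_def using s assms(6) by blast
qed

lemma GH_space_comb:
  assumes b: "b \<in> GH_space A" and c: "c \<in> GH_space A"
  shows "(\<lambda>X Y Z. s * b X Y Z + t * c X Y Z) \<in> GH_space A"
proof (rule GH_spaceI)
  show "s * b X Y Z + t * c X Y Z = - (s * b X Z Y + t * c X Z Y)" for X Y Z
    using GH_spaceD(3)[OF b, of X Y Z] GH_spaceD(3)[OF c, of X Y Z] by simp
qed (simp_all add: GH_space_simps[OF b] GH_space_simps[OF c] GH_spaceD(4)[OF b]
    GH_spaceD(4)[OF c] algebra_simps)

lemma GH_space_twist:
  assumes b: "b \<in> GH_space A"
  shows "(\<lambda>X Y Z. b (A X) (A Y) Z) \<in> GH_space A"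
proof (rule GH_spaceI)
  show "b (A X) (A Y) Z = - b (A X) (A Z) Y" for X Y Z
    using GH_spaceD(3)[OF b, of "A X" "A Y" Z] GH_spaceD(5)[OF b, of "A X" Z Y] by simp
qed (simp_all add: GH_space_simps[OF b] GH_spaceD(5)[OF b] algebra_simps)

lemma GH_space_w4:
  assumes "linear \<beta>"
  shows "w4 \<beta> \<in> GH_space A"
  by (rule GH_spaceI) (simp_all add: w4_def algebra_simps linear_neg[OF assms]
      linear_add[OF assms] linear_scale[OF assms])

text \<open>The first term contributes \<open>DIM('b)\<close>, the second -1, the third nothing
  because \<open>h e (A e) = 0\<close>, and the last -1 because
  \<open>A (A Z) = - Z\<close>.\<close>

lemma trace_w4:
  fixes \<beta> :: "'b \<Rightarrow> real"
  assumes E: "orthonormal_basis_wrt h E" and \<beta>: "linear \<beta>"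
  shows "(\<Sum>e\<in>E. w4 \<beta> e e Z) = (real DIM('b) - 2) * \<beta> Z"
proof -
  have lA: "linear (\<lambda>x. \<beta> (A x))" using \<beta> lin by (auto simp: linear_iff)
  have 1: "(\<Sum>e\<in>E. h e e * \<beta> Z) = DIM('b) * \<beta> Z"
    using E orthonormal_card[OF E] by (simp add: orthonormal_basis_wrt_def)
  have 2: "(\<Sum>e\<in>E. h e Y * \<beta> e) = \<beta> Y" "(\<Sum>e\<in>E. h e Y * \<beta> (A e)) = \<beta> (A Y)" for Y
    using orthonormal_contract[OF E \<beta>, of Y] orthonormal_contract[OF E lA, of Y]
    by (simp_all add: sym)
  show ?thesis
    unfolding w4_def sum.distrib sum_subtractf 1 2
    by (simp add: linear_neg[OF \<beta>] algebra_simps)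
qed

lemma w4_twist: "linear \<beta> \<Longrightarrow> w4 \<beta> (A X) (A Y) Z = w4 \<beta> X Y Z"
  using skew[of X Y] skew[of X Z] skew[of X "A Z"] unfolding w4_def
  by (simp add: linear_neg orth algebra_simps)

text \<open>Polarisation makes \<open>b\<close> skew in the first two slots, hence totally skew; the
  anti-invariance in the last two slots then moves to the first two.\<close>

lemma GH_class_1_twist:
  assumes "b \<in> GH_class h A 1"
  shows "b (A X) (A Y) Z = - b X Y Z" "b X Y Z = b Y Z X"
proof -
  have b: "b \<in> GH_space A" and s: "b X X Z = 0" for X Z
    using assms by (auto simp: GH_class_def)
  note D = GH_spaceD[OF b]
  have alt: "b X Y Z = - b Y X Z" for X Y Z
    using s[of "X + Y" Z] s[of X Z] s[of Y Z] by (simp add: GH_space_simps[OF b])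
  show cyc: "b X Y Z = b Y Z X" for X Y Z
    using alt[of X Y Z] D(3)[of Y X Z] by simp
  show "b (A X) (A Y) Z = - b X Y Z"
    using cyc[of Z "A X" "A Y"] cyc[of Z X Y] D(4)[of Z X Y] by simp
qed

text \<open>The defect \<open>q\<close> of the identity is symmetric in its first two slots and skew
  in its last two, and only 0 has both symmetries.\<close>

lemma GH_class_2_twist:
  assumes "b \<in> GH_class h A 2"
  shows "b (A X) (A Y) Z = - b X Y Z"
proof -
  have b: "b \<in> GH_space A" and cyc: "b X Y Z + b Y Z X + b Z X Y = 0" for X Y Z
    using assms by (auto simp: GH_class_def)
  note D = GH_spaceD[OF b]
  define q where "q X Y Z = b (A X) (A Y) Z + b X Y Z" for X Y Z
  have s: "q X Y Z = q Y X Z" for X Y Z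
    using cyc[of "A X" "A Y" Z] cyc[of X Y Z] D(4)[of Z X Y]
      D(3)[of "A Y" Z "A X"] D(3)[of Y Z X]
    unfolding q_def by linarith
  have t: "q X Y Z = - q X Z Y" for X Y Z
    using D(3)[of X Y Z] D(5)[of "A X" Y Z] D(3)[of "A X" Y "A Z"]
    unfolding q_def by linarith
  have "q X Y Z = 0"
    using s[of X Y Z] t[of Y X Z] s[of Y Z X] t[of Z Y X] s[of Z X Y] t[of X Z Y] by linarith
  then show ?thesis unfolding q_def by linarith
qed

lemma GH_class_4_iff: "b \<in> GH_class h A 4 \<longleftrightarrow> (\<exists>\<beta>. linear \<beta> \<and> b = w4 \<beta>)"
proof
  assume "b \<in> GH_class h A 4"
  then obtain \<beta> where "linear \<beta>" "\<And>X Y Z. b X Y Z = w4 \<beta> X Y Z"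
    unfolding GH_class_def w4_def by auto
  then show "\<exists>\<beta>. linear \<beta> \<and> b = w4 \<beta>" by (auto simp: fun_eq_iff)
next
  assume "\<exists>\<beta>. linear \<beta> \<and> b = w4 \<beta>"
  then show "b \<in> GH_class h A 4"
    using GH_space_w4 unfolding GH_class_def by (auto simp: w4_def)
qed

text \<open>The parts of \<open>b\<close> in \<open>W\<^sub>1 \<oplus> W\<^sub>2\<close> and in \<open>W\<^sub>3 \<oplus> W\<^sub>4\<close>.\<close>

definition anti_part :: "('b \<Rightarrow> 'b \<Rightarrow> 'b \<Rightarrow> real) \<Rightarrow> 'b \<Rightarrow> 'b \<Rightarrow> 'b \<Rightarrow> real" where
  "anti_part b X Y Z = (b X Y Z - b (A X) (A Y) Z) / 2"
definition inv_part :: "('b \<Rightarrow> 'b \<Rightarrow> 'b \<Rightarrow> real) \<Rightarrow> 'b \<Rightarrow> 'b \<Rightarrow> 'b \<Rightarrow> real" where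
  "inv_part b X Y Z = (b X Y Z + b (A X) (A Y) Z) / 2"
definition skew_part :: "('b \<Rightarrow> 'b \<Rightarrow> 'b \<Rightarrow> real) \<Rightarrow> 'b \<Rightarrow> 'b \<Rightarrow> 'b \<Rightarrow> real" where
  "skew_part b X Y Z = (anti_part b X Y Z + anti_part b Y Z X + anti_part b Z X Y) / 3"

lemma anti_part_space: "b \<in> GH_space A \<Longrightarrow> anti_part b \<in> GH_space A"
  using GH_space_comb[OF _ GH_space_twist, of b b "1/2" "-1/2"]
  by (auto simp: anti_part_def[abs_def] algebra_simps diff_divide_distrib)

lemma inv_part_space: "b \<in> GH_space A \<Longrightarrow> inv_part b \<in> GH_space A"
  using GH_space_comb[OF _ GH_space_twist, of b b "1/2" "1/2"]
  by (auto simp: inv_part_def[abs_def] algebra_simps add_divide_distrib)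

text \<open>On this part \<open>A\<close> moves freely between all three slots, so the cyclic
  average \<open>skew_part\<close> stays in \<open>GH_space A\<close>.\<close>

lemma anti_part_slots:
  assumes b: "b \<in> GH_space A"
  shows "anti_part b (A X) Y Z = anti_part b X Y (A Z)" "anti_part b X (A Y) Z = anti_part b X Y (A Z)"
  by (simp_all add: anti_part_def GH_spaceD(5)[OF b] GH_space_simps[OF b])

lemma skew_part_class:
  assumes b: "b \<in> GH_space A"
  shows "skew_part b \<in> GH_class h A 1"
proof -
  note a = anti_part_space[OF b]
  note D = GH_spaceD[OF a] and S = GH_space_simps[OF a] and sl = anti_part_slots[OF b]
  have "skew_part b \<in> GH_space A"
  proof (rule GH_spaceI)
    show "skew_part b X Y Z = - skew_part b X Z Y" for X Y Z
      unfolding skew_part_def D(3)[of X Y Z] D(3)[of Y Z X] D(3)[of Z X Y] by (simp add: field_simps)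
  qed (simp_all add: skew_part_def sl S field_simps)
  moreover have "skew_part b X X Z = 0" for X Z
    using D(3)[of X X Z] D(3)[of X Z X] D(3)[of Z X X] by (simp add: skew_part_def)
  ultimately show ?thesis by (simp add: GH_class_def)
qed

text \<open>The divisor is the constant of \<open>trace_w4\<close>: in dimension above 2,
  \<open>lee\<close> recovers \<open>\<beta>\<close> from \<open>w4 \<beta>\<close>.\<close>

definition lee :: "('b \<Rightarrow> 'b \<Rightarrow> 'b \<Rightarrow> real) \<Rightarrow> 'b \<Rightarrow> real" where
  "lee b Z = (\<Sum>e\<in>onb. b e e Z) / (real DIM('b) - 2)"

definition GH_part :: "('b \<Rightarrow> 'b \<Rightarrow> 'b \<Rightarrow> real) \<Rightarrow> nat \<Rightarrow> 'b \<Rightarrow> 'b \<Rightarrow> 'b \<Rightarrow> real" where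
  "GH_part b i X Y Z =
     (if i = 1 then skew_part b X Y Z else if i = 2 then anti_part b X Y Z - skew_part b X Y Z
      else if i = 3 then inv_part b X Y Z - w4 (lee b) X Y Z else w4 (lee b) X Y Z)"

lemma linear_lee: "b \<in> GH_space A \<Longrightarrow> linear (lee b)"
  by (rule linearI) (simp_all add: lee_def GH_space_simps sum.distrib add_divide_distrib
      flip: sum_distrib_left)

lemma trace_twist:
  assumes "b \<in> GH_space A" "orthonormal_basis_wrt h E"
  shows "(\<Sum>e\<in>E. b (A e) (A e) Z) = (\<Sum>e\<in>E. b e e Z)"
  using trace_invariant[OF assms(2) GH_space_bilinear12[OF assms(1)] lin orth] .

lemma trace_anti_twist:
  assumes "b \<in> GH_space A" and "\<And>X Y Z. b (A X) (A Y) Z = - b X Y Z"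
    and "orthonormal_basis_wrt h E"
  shows "(\<Sum>e\<in>E. b e e Z) = 0"
  using trace_twist[OF assms(1,3), of Z] by (simp add: assms(2) sum_negf)

lemma trace_inv_part:
  assumes "b \<in> GH_space A" "orthonormal_basis_wrt h E"
  shows "(\<Sum>e\<in>E. inv_part b e e Z) = (\<Sum>e\<in>E. b e e Z)"
  using trace_twist[OF assms, of Z]
  by (simp add: inv_part_def sum.distrib flip: sum_divide_distrib)

lemma trace_lee:
  assumes "b \<in> GH_space A" "orthonormal_basis_wrt h E" "DIM('b) > 2"
  shows "(\<Sum>e\<in>E. b e e Z) = (real DIM('b) - 2) * lee b Z"
  using trace_unique[OF assms(2) onb GH_space_bilinear12[OF assms(1)], of Z] assms(3)
  by (simp add: lee_def)

lemma GH_part_class: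
  assumes b: "b \<in> GH_space A" and dim: "DIM('b) > 2" and i: "i \<in> {1..4}"
  shows "GH_part b i \<in> GH_class h A i"
proof -
  note lee = linear_lee[OF b]
  have c: "skew_part b \<in> GH_space A" using skew_part_class[OF b] by (simp add: GH_class_def)
  have 1: "GH_part b 1 = skew_part b" and 4: "GH_part b 4 = w4 (lee b)"
    by (simp_all add: GH_part_def fun_eq_iff)
  have "GH_part b 2 \<in> GH_space A"
    using GH_space_comb[OF anti_part_space[OF b] c, of 1 "-1"] by (simp add: GH_part_def[abs_def])
  moreover have "GH_part b 2 X Y Z + GH_part b 2 Y Z X + GH_part b 2 Z X Y = 0" for X Y Z
    by (simp add: GH_part_def skew_part_def field_simps)
  ultimately have 2: "GH_part b 2 \<in> GH_class h A 2" by (simp add: GH_class_def)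
  have "GH_part b 3 \<in> GH_space A"
    using GH_space_comb[OF inv_part_space[OF b] GH_space_w4[OF lee], of 1 "-1"]
    by (simp add: GH_part_def[abs_def])
  moreover have "GH_part b 3 (A X) (A Y) Z = GH_part b 3 X Y Z" for X Y Z
    by (simp add: GH_part_def inv_part_def w4_twist[OF lee] GH_space_simps[OF b])
  moreover have "(\<Sum>e\<in>E. GH_part b 3 e e Z) = 0" if E: "orthonormal_basis_wrt h E" for E Z
    by (simp add: GH_part_def sum_subtractf trace_inv_part[OF b E] trace_w4[OF E lee] trace_lee[OF b E dim])
  ultimately have 3: "GH_part b 3 \<in> GH_class h A 3" by (simp add: GH_class_def)
  have "i = 1 \<or> i = 2 \<or> i = 3 \<or> i = 4" using i by auto
  then show ?thesis
    using 2 3 skew_part_class[OF b] lee unfolding 1[symmetric]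
    by (auto simp: GH_class_4_iff 4)
qed

lemma GH_part_sum: "b X Y Z = (\<Sum>j=1..4. GH_part b j X Y Z)"
proof -
  have "{1..4} = {1, 2, 3, 4::nat}" by auto
  then show ?thesis by (simp add: GH_part_def anti_part_def inv_part_def diff_divide_distrib add_divide_distrib)
qed

text \<open>Twisting the first two slots by \<open>A\<close> has sign -1 on W1 and W2 and +1 on W3
  and W4, which isolates the two sums. The cyclic sum kills W2 and triples W1; the trace sees W4
  alone and so fixes its one-form.\<close>

lemma GH_part_unique:
  assumes b: "b \<in> GH_space A" and dim: "DIM('b) > 2"
    and d: "\<And>j. j \<in> {1..4} \<Longrightarrow> d j \<in> GH_class h A j"
    and sum: "\<And>X Y Z. b X Y Z = (\<Sum>j=1..4. d j X Y Z)"
    and i: "i \<in> {1..4}"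
  shows "d i = GH_part b i"
proof -
  have d1: "d 1 \<in> GH_class h A 1" and d2: "d 2 \<in> GH_class h A 2"
    and d3: "d 3 \<in> GH_class h A 3" and d4: "d 4 \<in> GH_class h A 4"
    using d by auto
  have sp: "d j \<in> GH_space A" if "j \<in> {1..4}" for j
    using d[OF that] by (simp add: GH_class_def)
  have d2c: "d 2 X Y Z + d 2 Y Z X + d 2 Z X Y = 0" for X Y Z
    using d2 by (simp add: GH_class_def)
  have d3t: "d 3 (A X) (A Y) Z = d 3 X Y Z"
    and d3s: "orthonormal_basis_wrt h E \<Longrightarrow> (\<Sum>e\<in>E. d 3 e e Z) = 0" for X Y Z E
    using d3 by (simp_all add: GH_class_def)
  obtain \<beta> where \<beta>: "linear \<beta>" and d4\<beta>: "d 4 = w4 \<beta>"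
    using d4 by (auto simp: GH_class_4_iff)
  have "{1..4} = {1, 2, 3, 4::nat}" by auto
  then have s: "b X Y Z = d 1 X Y Z + d 2 X Y Z + d 3 X Y Z + d 4 X Y Z" for X Y Z
    by (simp add: sum)
  have t4: "d 4 (A X) (A Y) Z = d 4 X Y Z" for X Y Z
    by (simp add: d4\<beta> w4_twist[OF \<beta>])
  have anti_part: "anti_part b X Y Z = d 1 X Y Z + d 2 X Y Z" for X Y Z
    using d3t t4 GH_class_1_twist(1)[OF d1] GH_class_2_twist[OF d2]
    by (simp add: anti_part_def s)
  have inv_part: "inv_part b X Y Z = d 3 X Y Z + d 4 X Y Z" for X Y Z
    using d3t t4 GH_class_1_twist(1)[OF d1] GH_class_2_twist[OF d2]
    by (simp add: inv_part_def s)
  have skew_part: "skew_part b X Y Z = d 1 X Y Z" for X Y Z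
    using d2c[of X Y Z] GH_class_1_twist(2)[OF d1, of X Y Z] GH_class_1_twist(2)[OF d1, of Y Z X]
    by (simp add: skew_part_def anti_part)
  have "lee b Z = \<beta> Z" for Z
  proof -
    have "(real DIM('b) - 2) * lee b Z = (\<Sum>e\<in>onb. b e e Z)"
      using trace_lee[OF b onb dim] by simp
    also have "\<dots> = (real DIM('b) - 2) * \<beta> Z"
      unfolding s sum.distrib
      using trace_anti_twist[OF sp GH_class_1_twist(1)[OF d1] onb, of Z]
        trace_anti_twist[OF sp GH_class_2_twist[OF d2] onb, of Z] d3s[OF onb, of Z]
        trace_w4[OF onb \<beta>, of Z] by (simp add: d4\<beta>)
    finally show ?thesis using dim by simp
  qed
  then have "lee b = \<beta>" by (rule ext)
  then have "GH_part b 4 = d 4" by (simp add: GH_part_def[abs_def] d4\<beta>)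
  moreover have "GH_part b 3 = d 3"
    using \<open>lee b = \<beta>\<close> by (simp add: GH_part_def[abs_def] inv_part d4\<beta>)
  moreover have "GH_part b 1 = d 1" "GH_part b 2 = d 2"
    by (simp_all add: GH_part_def[abs_def] skew_part anti_part)
  moreover have "i = 1 \<or> i = 2 \<or> i = 3 \<or> i = 4" using i by auto
  ultimately show ?thesis by auto
qed

text \<open>Replaces the definite description by explicit formulas, from which the vanishing
  criteria below are read off.\<close>

lemma GH_component_eq:
  assumes b: "b \<in> GH_space A" and dim: "DIM('b) > 2" and i: "i \<in> {1..4}"
  shows "GH_component h A i b = GH_part b i"
  unfolding GH_component_def
proof (rule the_equality)
  show "\<exists>d. (\<forall>j\<in>{1..4}. d j \<in> GH_class h A j) \<and>
    (\<forall>X Y Z. b X Y Z = (\<Sum>j=1..4. d j X Y Z)) \<and> GH_part b i = d i"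
    using GH_part_class[OF b dim] GH_part_sum[of b] by (intro exI[of _ "GH_part b"]) blast
qed (use GH_part_unique[OF b dim _ _ i] in blast)

lemma component_1_zero_iff:
  assumes "b \<in> GH_space A" "DIM('b) > 2"
  shows "(\<forall>X Y Z. GH_component h A 1 b X Y Z = 0) \<longleftrightarrow> (\<forall>X Y Z. skew_part b X Y Z = 0)"
  using GH_component_eq[OF assms, of 1] by (simp add: GH_part_def)

lemma component_2_zero_iff:
  assumes "b \<in> GH_space A" "DIM('b) > 2"
  shows "(\<forall>X Y Z. GH_component h A 2 b X Y Z = 0) \<longleftrightarrow> (\<forall>X Y Z. anti_part b X Y Z = skew_part b X Y Z)"
  using GH_component_eq[OF assms, of 2] by (simp add: GH_part_def)

text \<open>The one-form may be left existential: comparing traces forces it to be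
  \<open>lee b\<close>.\<close>

lemma component_3_zero_iff:
  assumes b: "b \<in> GH_space A" and dim: "DIM('b) > 2"
  shows "(\<forall>X Y Z. GH_component h A 3 b X Y Z = 0) \<longleftrightarrow>
    (\<exists>\<beta>. linear \<beta> \<and> (\<forall>X Y Z. inv_part b X Y Z = w4 \<beta> X Y Z))"
proof -
  have "lee b = \<beta>" if \<beta>: "linear \<beta>" "\<And>X Y Z. inv_part b X Y Z = w4 \<beta> X Y Z" for \<beta>
  proof
    fix Z show "lee b Z = \<beta> Z"
      using trace_lee[OF b onb dim, of Z] trace_inv_part[OF b onb, of Z] trace_w4[OF onb \<beta>(1), of Z] dim
      by (simp add: \<beta>(2))
  qed
  then show ?thesis
    using GH_component_eq[OF assms, of 3] linear_lee[OF b] by (auto simp: GH_part_def)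
qed

lemma component_4_zero_iff:
  assumes b: "b \<in> GH_space A" and dim: "DIM('b) > 2"
  shows "(\<forall>X Y Z. GH_component h A 4 b X Y Z = 0) \<longleftrightarrow> (\<forall>Z. (\<Sum>e\<in>onb. b e e Z) = 0)"
proof -
  have "(\<forall>X Y Z. w4 (lee b) X Y Z = 0) \<longleftrightarrow> (\<forall>Z. lee b Z = 0)"
  proof (intro iffI allI)
    fix Z assume "\<forall>X Y Z. w4 (lee b) X Y Z = 0"
    then have "(real DIM('b) - 2) * lee b Z = 0"
      using trace_w4[OF onb linear_lee[OF b], of Z] by simp
    then show "lee b Z = 0" using dim by simp
  qed (simp add: w4_def)
  then show ?thesis
    using GH_component_eq[OF assms, of 4] dim by (simp add: GH_part_def lee_def)
qed

end

section \<open>Quaternionic linear algebra\<close>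

locale quaternionic_form = inner_form h for h :: "'b::euclidean_space \<Rightarrow> 'b \<Rightarrow> real" +
  fixes I J K :: "'b \<Rightarrow> 'b"
  assumes linI: "linear I" and linJ: "linear J" and linK: "linear K"
    and II: "I (I x) = - x" and JJ: "J (J x) = - x"
    and IJ: "I (J x) = K x" and JI: "J (I x) = - K x"
    and hI: "h (I x) (I y) = h x y" and hJ: "h (J x) (J y) = h x y"
begin

lemma KI: "K (I x) = J x"
  by (simp add: linear_neg[OF linI] JI II flip: IJ)

lemma IK: "I (K x) = - J x"
  by (simp add: II flip: IJ)

lemma KJ: "K (J x) = - I x"
  by (simp add: JJ linear_neg[OF linI] flip: IJ)

lemma JK: "J (K x) = I x"
  using JI[of "J x"] KJ[of x] by (simp add: IJ)

lemma KK: "K (K x) = - x"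
  using IJ[of "K x"] by (simp add: JK II)

lemma hK: "h (K x) (K y) = h x y"
  by (simp add: hI hJ flip: IJ)

lemma rotate: "quaternionic_form h J K I"
  by (intro quaternionic_form.intro quaternionic_form_axioms.intro inner_form_axioms)
    (fact linI linJ linK JJ KK JK KJ hJ hK)+

end

sublocale quaternionic_form \<subseteq> I: hermitian_form h I
  by (intro hermitian_form.intro hermitian_form_axioms.intro inner_form_axioms) (fact linI II hI)+
sublocale quaternionic_form \<subseteq> J: hermitian_form h J
  by (intro hermitian_form.intro hermitian_form_axioms.intro inner_form_axioms) (fact linJ JJ hJ)+
sublocale quaternionic_form \<subseteq> K: hermitian_form h K
  by (intro hermitian_form.intro hermitian_form_axioms.intro inner_form_axioms) (fact linK KK hK)+

context quaternionic_form
begin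

lemmas quat_mult [simp] = IJ JI JK KJ KI IK

text \<open>Tensors in \<open>X\<close> with values in the symmetric bilinear forms of \<open>(Y, Z)\<close> invariant under
  \<open>I\<close>, \<open>J\<close>, \<open>K\<close>: a copy of \<open>T\<^sup>* \<otimes> \<Lambda>\<^sup>2 E\<close>.\<close>

definition qten :: "('b \<Rightarrow> 'b \<Rightarrow> 'b \<Rightarrow> real) \<Rightarrow> bool" where
  "qten u \<longleftrightarrow> (\<forall>Y Z. linear (\<lambda>X. u X Y Z)) \<and> (\<forall>X. bilinear (u X)) \<and>
     (\<forall>X Y Z. u X Y Z = u X Z Y) \<and> (\<forall>X Y Z. u X (I Y) (I Z) = u X Y Z) \<and>
     (\<forall>X Y Z. u X (J Y) (J Z) = u X Y Z)"

lemma qtenD: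
  assumes "qten u"
  shows "linear (\<lambda>X. u X Y Z)" "bilinear (u X)" "u X Y Z = u X Z Y"
    "u X (I Y) (I Z) = u X Y Z" "u X (J Y) (J Z) = u X Y Z"
  using assms unfolding qten_def by blast+

lemma qten_linear_simps:
  assumes "qten u"
  shows "u (- X) Y Z = - u X Y Z" "u X (- Y) Z = - u X Y Z" "u X Y (- Z) = - u X Y Z"
    "u (X + X') Y Z = u X Y Z + u X' Y Z" "u X (Y + Y') Z = u X Y Z + u X Y' Z"
    "u X Y (Z + Z') = u X Y Z + u X Y Z'"
    "u (r *\<^sub>R X) Y Z = r * u X Y Z" "u X (r *\<^sub>R Y) Z = r * u X Y Z"
    "u X Y (r *\<^sub>R Z) = r * u X Y Z"
proof -
  note l = qtenD(1)[OF assms, of Y Z] and B = qtenD(2)[OF assms, of X]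
  show "u (- X) Y Z = - u X Y Z" "u (X + X') Y Z = u X Y Z + u X' Y Z"
    "u (r *\<^sub>R X) Y Z = r * u X Y Z"
    using linear_neg[OF l] linear_add[OF l] linear_scale[OF l] by simp_all
  show "u X (- Y) Z = - u X Y Z" "u X Y (- Z) = - u X Y Z"
    "u X (Y + Y') Z = u X Y Z + u X Y' Z" "u X Y (Z + Z') = u X Y Z + u X Y Z'"
    "u X (r *\<^sub>R Y) Z = r * u X Y Z" "u X Y (r *\<^sub>R Z) = r * u X Y Z"
    using bilinear_lneg[OF B] bilinear_rneg[OF B] bilinear_ladd[OF B] bilinear_radd[OF B]
      bilinear_lmul[OF B] bilinear_rmul[OF B] by simp_all
qed

lemma qten_shift:
  assumes "qten u"
  shows "u X Y (I Z) = - u X (I Y) Z" "u X Y (J Z) = - u X (J Y) Z" "u X Y (K Z) = - u X (K Y) Z"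
proof -
  show i: "u X Y (I Z) = - u X (I Y) Z" and j: "u X Y (J Z) = - u X (J Y) Z" for Y Z
    using qtenD(4)[OF assms, of X Y "I Z"] qtenD(5)[OF assms, of X Y "J Z"]
    by (simp_all add: qten_linear_simps[OF assms])
  show "u X Y (K Z) = - u X (K Y) Z"
    unfolding IJ[symmetric, of Z] i j by (simp add: qten_linear_simps[OF assms])
qed

lemma qtenI:
  assumes "\<And>X X' Y Z. u (X + X') Y Z = u X Y Z + u X' Y Z"
    and "\<And>r X Y Z. u (r *\<^sub>R X) Y Z = r * u X Y Z"
    and "\<And>X Y Z Z'. u X Y (Z + Z') = u X Y Z + u X Y Z'"
    and "\<And>r X Y Z. u X Y (r *\<^sub>R Z) = r * u X Y Z"
    and s: "\<And>X Y Z. u X Y Z = u X Z Y"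
    and "\<And>X Y Z. u X (I Y) (I Z) = u X Y Z" "\<And>X Y Z. u X (J Y) (J Z) = u X Y Z"
  shows "qten u"
proof -
  have "linear (\<lambda>Y. u X Y Z)" for X Z
    unfolding s[of X _ Z] by (rule linearI) (simp_all add: assms(3,4))
  moreover have "linear (\<lambda>X. u X Y Z)" "linear (u X Y)" for X Y Z
    by (rule linearI; simp add: assms(1-4))+
  ultimately show ?thesis
    unfolding qten_def bilinear_def using assms(5-7) by blast
qed

text \<open>With \<open>T = E \<otimes> H\<close>, the exchange of the \<open>H\<close>-factors of \<open>X \<otimes> Y\<close> is
  \<open>(1 - I \<otimes> I - J \<otimes> J - K \<otimes> K) / 2\<close>. Composed with \<open>X \<leftrightarrow> Y\<close> it exchanges the \<open>E\<close>-factors, so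
  \<open>alt u\<close> is six times the antisymmetrization of \<open>u\<close> in the three \<open>E\<close>-factors.\<close>

definition alt :: "('b \<Rightarrow> 'b \<Rightarrow> 'b \<Rightarrow> real) \<Rightarrow> 'b \<Rightarrow> 'b \<Rightarrow> 'b \<Rightarrow> real" where
  "alt u X Y Z = 2 * u X Y Z
     - u Y X Z + u (I Y) (I X) Z + u (J Y) (J X) Z + u (K Y) (K X) Z
     - u Z X Y + u (I Z) (I X) Y + u (J Z) (J X) Y + u (K Z) (K X) Y"

text \<open>The symmetric product of \<open>h X\<close> and \<open>\<theta>\<close>, summed over the
  simultaneous action of 1, \<open>I\<close>, \<open>J\<close>, \<open>K\<close> on \<open>Y\<close>
  and \<open>Z\<close>: four times its projection to the invariant forms.\<close>

definition sform :: "('b \<Rightarrow> real) \<Rightarrow> 'b \<Rightarrow> 'b \<Rightarrow> 'b \<Rightarrow> real" where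
  "sform \<theta> X Y Z = h X Y * \<theta> Z + h X Z * \<theta> Y
     + h X (I Y) * \<theta> (I Z) + h X (I Z) * \<theta> (I Y)
     + h X (J Y) * \<theta> (J Z) + h X (J Z) * \<theta> (J Y)
     + h X (K Y) * \<theta> (K Z) + h X (K Z) * \<theta> (K Y)"

definition tr :: "('b \<Rightarrow> 'b \<Rightarrow> 'b \<Rightarrow> real) \<Rightarrow> 'b \<Rightarrow> real" where
  "tr u Z = (\<Sum>e\<in>onb. u e e Z)"

text \<open>Each class expresses that the component with its number vanishes; 1 and 2 are applied to
  the tensors u, 3 and 4 to the tensors v. The first two are the kernel and the image of the
  antisymmetrization.\<close>

definition class1 where "class1 u \<longleftrightarrow> qten u \<and> (\<forall>X Y Z. alt u X Y Z = 0)"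
definition class2 where "class2 u \<longleftrightarrow> qten u \<and> (\<forall>X Y Z. alt u X Y Z = 6 * u X Y Z)"
definition class3 where "class3 u \<longleftrightarrow> qten u \<and> (\<exists>\<theta>. linear \<theta> \<and> (\<forall>X Y Z. u X Y Z = sform \<theta> X Y Z))"
definition class4 where "class4 u \<longleftrightarrow> qten u \<and> (\<forall>Z. tr u Z = 0)"

text \<open>The sums over \<open>I\<close>, \<open>J\<close>, \<open>K\<close> are cyclically
  symmetric, and invariance under two of the three gives the third. This allows
  \<open>GH_link\<close>, proved for \<open>I\<close>, to be used for \<open>J\<close> and
  \<open>K\<close>.\<close>

lemma rotate_eqs:
  "quaternionic_form.alt J K I u = alt u" "quaternionic_form.sform h J K I \<theta> = sform \<theta>"
  "quaternionic_form.qten J K u = qten u"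
proof -
  interpret rot: quaternionic_form h J K I by (rule rotate)
  show "rot.alt u = alt u" "rot.sform \<theta> = sform \<theta>"
    by (simp_all add: fun_eq_iff rot.alt_def alt_def rot.sform_def sform_def)
  have "u X (I Y) (I Z) = u X Y Z" if "rot.qten u" for X Y Z
    using rot.qten_shift(3)[OF that, of X "I Y" Z] by (simp add: rot.qten_linear_simps[OF that])
  moreover have "u X (K Y) (K Z) = u X Y Z" if "qten u" for X Y Z
    using qten_shift(3)[OF that, of X "K Y" Z] by (simp add: qten_linear_simps[OF that])
  ultimately show "rot.qten u = qten u"
    unfolding rot.qten_def qten_def by blast
qed

lemma rotate_classes:
  "quaternionic_form.class1 J K I u = class1 u" "quaternionic_form.class2 J K I u = class2 u"
  "quaternionic_form.class3 h J K I u = class3 u" "quaternionic_form.class4 h J K u = class4 u"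
proof -
  interpret rot: quaternionic_form h J K I by (rule rotate)
  show "rot.class1 u = class1 u" "rot.class2 u = class2 u"
   "rot.class3 u = class3 u" "rot.class4 u = class4 u"
    by (simp_all add: rot.class1_def class1_def rot.class2_def class2_def
      rot.class3_def class3_def rot.class4_def class4_def rotate_eqs rot.tr_def tr_def)
qed

lemma linear_sform_arg: "linear \<theta> \<Longrightarrow> linear (\<lambda>x. \<theta> (I x))" "linear \<theta> \<Longrightarrow> linear (\<lambda>x. \<theta> (J x))"
  "linear \<theta> \<Longrightarrow> linear (\<lambda>x. \<theta> (K x))"
  by (simp_all add: linear_iff)

lemma sform_comp:
  assumes "linear \<theta>"
  shows "sform \<theta> (I X) Y Z = sform (\<lambda>x. \<theta> (I x)) X Y Z"
    "sform \<theta> (J X) Y Z = sform (\<lambda>x. \<theta> (J x)) X Y Z"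
    "sform \<theta> (K X) Y Z = sform (\<lambda>x. \<theta> (K x)) X Y Z"
  by (simp_all add: sform_def I.skew J.skew K.skew linear_neg[OF assms])

text \<open>The quaternion relations merely permute the four terms of each exchange:
  \<open>A\<close> acts on an H-factor, \<open>alt\<close> on the E-factors.\<close>

lemma alt_comp:
  assumes "qten u"
  shows "alt (\<lambda>X. u (I X)) X Y Z = alt u (I X) Y Z" "alt (\<lambda>X. u (J X)) X Y Z = alt u (J X) Y Z"
    "alt (\<lambda>X. u (K X)) X Y Z = alt u (K X) Y Z"
  by (simp_all add: alt_def qten_linear_simps[OF assms])

lemma tr_comp:
  assumes u: "qten u"
  shows "tr (\<lambda>X. u (I X)) Z = tr u (I Z)" "tr (\<lambda>X. u (J X)) Z = tr u (J Z)"
    "tr (\<lambda>X. u (K X)) Z = tr u (K Z)"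
proof -
  have l: "linear (\<lambda>x. u x Y Z)" "linear (\<lambda>y. u X y Z)" "linear (u X Y)" for X Y Z
    using qtenD(1,2)[OF u] by (auto simp: bilinear_def)
  have b: "bilinear (\<lambda>x y. u x (A y) Z)" if "linear A" for A
    using l that linear_compose[OF that l(2), unfolded o_def] by (simp add: bilinear_def)
  show "tr (\<lambda>X. u (I X)) Z = tr u (I Z)"
    using trace_invariant[OF onb b[OF linI] linI hI]
    by (simp add: tr_def qten_shift[OF u] qten_linear_simps[OF u] sum_negf)
  show "tr (\<lambda>X. u (J X)) Z = tr u (J Z)"
    using trace_invariant[OF onb b[OF linJ] linJ hJ]
    by (simp add: tr_def qten_shift[OF u] qten_linear_simps[OF u] sum_negf)
  show "tr (\<lambda>X. u (K X)) Z = tr u (K Z)"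
    using trace_invariant[OF onb b[OF linK] linK hK]
    by (simp add: tr_def qten_shift[OF u] qten_linear_simps[OF u] sum_negf)
qed

text \<open>The terms with \<open>Z\<close> in the second or third slot add up to 2 - 1 + 3 = 4
  traces. Of those with \<open>Z\<close> in front only \<open>u Z e e\<close> survives, since
  \<open>u X (A Y) Y = 0\<close> for \<open>A\<close> = \<open>I\<close>, \<open>J\<close>,
  \<open>K\<close>.\<close>

lemma tr_alt:
  assumes u: "qten u"
  shows "tr (alt u) Z = 4 * tr u Z - (\<Sum>e\<in>onb. u Z e e)"
proof -
  have l: "linear (\<lambda>x. u x Y Z)" "linear (\<lambda>y. u X y Z)" "linear (u X Y)" for X Y Z
    using qtenD(1,2)[OF u] by (auto simp: bilinear_def)
  have b: "bilinear (\<lambda>x y. u x y Z)"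
    using l by (simp add: bilinear_def)
  have z: "u X (I Y) Y = 0" "u X (J Y) Y = 0" "u X (K Y) Y = 0" for X Y
    using qtenD(3)[OF u, of X "I Y" Y] qtenD(3)[OF u, of X "J Y" Y] qtenD(3)[OF u, of X "K Y" Y]
    by (simp_all add: qten_shift[OF u])
  show ?thesis
    using trace_invariant[OF onb b linI hI] trace_invariant[OF onb b linJ hJ]
      trace_invariant[OF onb b linK hK]
    by (simp add: tr_def alt_def sum.distrib sum_subtractf z flip: sum_distrib_left)
qed

text \<open>The coefficient is DIM + 1 - 3: each of \<open>I\<close>, \<open>J\<close>,
  \<open>K\<close> contributes -1 through its square.\<close>

lemma tr_sform:
  assumes \<theta>: "linear \<theta>"
  shows "tr (sform \<theta>) Z = (real DIM('b) - 2) * \<theta> Z"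
proof -
  have 1: "(\<Sum>e\<in>onb. h e e * c) = real DIM('b) * c" for c
    using onb orthonormal_card[OF onb] by (simp add: orthonormal_basis_wrt_def)
  have 2: "(\<Sum>e\<in>onb. h e Y * \<phi> e) = \<phi> Y" if "linear \<phi>" for Y and \<phi> :: "'b \<Rightarrow> real"
    using orthonormal_contract[OF onb that, of Y] by (simp add: sym)
  show ?thesis
    unfolding tr_def sform_def sum.distrib 1 2[OF \<theta>] 2[OF linear_sform_arg(1)[OF \<theta>]]
      2[OF linear_sform_arg(2)[OF \<theta>]] 2[OF linear_sform_arg(3)[OF \<theta>]]
    by (simp add: linear_neg[OF \<theta>] algebra_simps)
qed

text \<open>By \<open>tr_alt\<close> the coefficient is 4 (DIM - 2) - 8. It vanishes in dimension 4,
  which explains the bound on the dimension in what follows.\<close>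

lemma tr_alt_sform:
  assumes \<theta>: "linear \<theta>" and q: "qten (sform \<theta>)"
  shows "tr (alt (sform \<theta>)) Z = (4 * real DIM('b) - 16) * \<theta> Z"
proof -
  have 2: "(\<Sum>e\<in>onb. h Y e * \<phi> e) = \<phi> Y" if "linear \<phi>" for Y and \<phi> :: "'b \<Rightarrow> real"
    using orthonormal_contract[OF onb that, of Y] by (simp add: sym)
  have 3: "h Z (I e) = - h (I Z) e" "h Z (J e) = - h (J Z) e" "h Z (K e) = - h (K Z) e" for e
    by (simp_all add: I.skew J.skew K.skew)
  \<comment> \<open>Each of the eight summands of \<open>sform\<close> contracts to
    \<open>\<theta> Z\<close>.\<close>
  have "(\<Sum>e\<in>onb. sform \<theta> Z e e) = 8 * \<theta> Z"
    unfolding sform_def 3 sum.distrib mult_minus_left sum_negf 2[OF \<theta>] 2[OF linear_sform_arg(1)[OF \<theta>]]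
      2[OF linear_sform_arg(2)[OF \<theta>]] 2[OF linear_sform_arg(3)[OF \<theta>]]
    by (simp add: linear_neg[OF \<theta>])
  then show ?thesis
    using tr_alt[OF q, of Z] tr_sform[OF \<theta>, of Z] by (simp add: algebra_simps)
qed

definition dep where
  "dep x y z \<longleftrightarrow> (\<exists>A\<in>{I, J, K}. \<exists>B\<in>{I, J, K}. \<exists>s t::real.
     \<forall>X Y Z. z X Y Z = s * x (A X) Y Z + t * y (B X) Y Z)"

lemma dep_sym: "dep x y z \<Longrightarrow> dep y x z"
  unfolding dep_def by (metis add.commute)

lemma alt_comb:
  "alt (\<lambda>X Y Z. s * x X Y Z + t * y X Y Z) X Y Z = s * alt x X Y Z + t * alt y X Y Z"
  by (simp add: alt_def algebra_simps)

lemma tr_comb: "tr (\<lambda>X Y Z. s * x X Y Z + t * y X Y Z) Z = s * tr x Z + t * tr y Z"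
  by (simp add: tr_def sum.distrib sum_distrib_left)

section \<open>Stability of the four classes under combinations of translates\<close>

lemma dep_alt:
  assumes "qten x" "qten y" "A \<in> {I, J, K}" "B \<in> {I, J, K}"
    and z: "\<And>X Y Z. z X Y Z = s * x (A X) Y Z + t * y (B X) Y Z"
  shows "alt z X Y Z = s * alt x (A X) Y Z + t * alt y (B X) Y Z"
    and "tr z Z = s * tr x (A Z) + t * tr y (B Z)"
proof -
  have z': "z = (\<lambda>X Y Z. s * x (A X) Y Z + t * y (B X) Y Z)"
    using z by (simp add: fun_eq_iff)
  show "alt z X Y Z = s * alt x (A X) Y Z + t * alt y (B X) Y Z"
    unfolding z' using assms(3,4) alt_comp[OF assms(1)] alt_comp[OF assms(2)]
    by (auto simp: alt_comb[of s "\<lambda>X. x (A X)" t "\<lambda>X. y (B X)"])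
  show "tr z Z = s * tr x (A Z) + t * tr y (B Z)"
    unfolding z' using assms(3,4) tr_comp[OF assms(1)] tr_comp[OF assms(2)]
    by (auto simp: tr_comb[of s "\<lambda>X. x (A X)" t "\<lambda>X. y (B X)"])
qed

lemma dep_zero:
  assumes "dep x y z" "qten x" "qten y" "\<And>X Y Z. x X Y Z = 0" "\<And>X Y Z. y X Y Z = 0"
  shows "z X Y Z = 0"
  using assms unfolding dep_def by auto

lemma dep_class1:
  assumes d: "dep x y z" and "class1 x" "class1 y" "qten z"
  shows "class1 z"
  using assms dep_alt(1)[of x y] unfolding dep_def class1_def by (metis add_0 mult_zero_right)

lemma dep_class2:
  assumes d: "dep x y z" and "class2 x" "class2 y" "qten z"
  shows "class2 z"
proof -
  obtain A B s t where AB: "A \<in> {I, J, K}" "B \<in> {I, J, K}"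
    and z: "\<And>X Y Z. z X Y Z = s * x (A X) Y Z + t * y (B X) Y Z"
    using d unfolding dep_def by blast
  show ?thesis
    using dep_alt(1)[of x y A B z s t, OF _ _ AB z] assms(2-4) by (simp add: class2_def z algebra_simps)
qed

lemma dep_class4:
  assumes d: "dep x y z" and "class4 x" "class4 y" "qten z"
  shows "class4 z"
  using assms dep_alt(2)[of x y] unfolding dep_def class4_def by (metis add_0 mult_zero_right)

lemma sform_comp':
  assumes "linear \<theta>" "A \<in> {I, J, K}"
  shows "sform \<theta> (A X) Y Z = sform (\<lambda>x. \<theta> (A x)) X Y Z" "linear (\<lambda>x. \<theta> (A x))"
  using assms sform_comp linear_sform_arg by auto

lemma dep_class3:
  assumes d: "dep x y z" and x: "class3 x" and y: "class3 y" and "qten z"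
  shows "class3 z"
proof -
  obtain A B s t where AB: "A \<in> {I, J, K}" "B \<in> {I, J, K}"
    and z: "\<And>X Y Z. z X Y Z = s * x (A X) Y Z + t * y (B X) Y Z"
    using d unfolding dep_def by blast
  obtain \<theta> \<eta> where \<theta>: "linear \<theta>" "\<And>X Y Z. x X Y Z = sform \<theta> X Y Z"
    and \<eta>: "linear \<eta>" "\<And>X Y Z. y X Y Z = sform \<eta> X Y Z"
    using x y unfolding class3_def by auto
  have "linear (\<lambda>x. s * \<theta> (A x) + t * \<eta> (B x))"
    using sform_comp'(2)[OF \<theta>(1) AB(1)] sform_comp'(2)[OF \<eta>(1) AB(2)]
    by (auto simp: linear_iff algebra_simps)
  moreover have "z X Y Z = sform (\<lambda>x. s * \<theta> (A x) + t * \<eta> (B x)) X Y Z" for X Y Z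
    unfolding z \<theta> \<eta> sform_comp'(1)[OF \<theta>(1) AB(1)] sform_comp'(1)[OF \<eta>(1) AB(2)]
    by (simp add: sform_def algebra_simps)
  ultimately show ?thesis using \<open>qten z\<close> by (auto simp: class3_def)
qed

lemma class_zero:
  assumes "qten u" "\<And>X Y Z. u X Y Z = 0"
  shows "class1 u" "class2 u" "class3 u" "class4 u"
  using assms by (auto simp: class1_def class2_def class3_def class4_def alt_def tr_def sform_def
      intro!: exI[of _ "\<lambda>_. 0"] linear_zero)

text \<open>Both \<open>tr z\<close> and \<open>tr (alt z)\<close> are fixed multiples of the same
  one-form, so any linear relation between them that violates the ratio of the two constants forces
  \<open>z = 0\<close>. The premise \<open>c\<close> receives exactly these data.\<close>

lemma class3_zero:
  assumes z: "class3 z"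
    and c: "\<And>\<theta>. linear \<theta> \<Longrightarrow> (\<And>X Y Z. z X Y Z = sform \<theta> X Y Z) \<Longrightarrow>
       (\<And>Z. tr z Z = (real DIM('b) - 2) * \<theta> Z) \<Longrightarrow>
       (\<And>Z. tr (alt z) Z = (4 * real DIM('b) - 16) * \<theta> Z) \<Longrightarrow> (\<And>Z. \<theta> Z = 0)"
  shows "z X Y Z = 0"
proof -
  obtain \<theta> where \<theta>: "linear \<theta>" "\<And>X Y Z. z X Y Z = sform \<theta> X Y Z"
    using z unfolding class3_def by auto
  have "z = sform \<theta>" using \<theta> by (simp add: fun_eq_iff)
  then have "\<theta> Z = 0" for Z
    using c[OF \<theta>] tr_sform[OF \<theta>(1)] tr_alt_sform[OF \<theta>(1)] z by (simp add: class3_def)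
  then show ?thesis by (simp add: \<theta>(2) sform_def)
qed

lemma class31_zero:
  assumes "class3 z" "class1 z" and dim: "DIM('b) > 4"
  shows "z X Y Z = 0"
proof (rule class3_zero[OF assms(1)])
  fix \<theta> Z assume "\<And>Z. tr (alt z) Z = (4 * real DIM('b) - 16) * \<theta> Z"
  from this[of Z] show "\<theta> Z = 0"
    using assms(2) dim by (simp add: class1_def tr_def)
qed

text \<open>Here \<open>alt z = 6 z\<close>, but 6 (DIM - 2) exceeds 4 DIM - 16 by 2 DIM + 4, which
  is positive.\<close>

lemma class32_zero:
  assumes "class3 z" "class2 z"
  shows "z X Y Z = 0"
proof (rule class3_zero[OF assms(1)])
  fix \<theta> Z assume 1: "\<And>Z. tr (alt z) Z = (4 * real DIM('b) - 16) * \<theta> Z"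
    and 2: "\<And>Z. tr z Z = (real DIM('b) - 2) * \<theta> Z"
  have "tr (alt z) Z = 6 * tr z Z"
    using assms(2) by (simp add: class2_def tr_def sum_distrib_left)
  then have "(2 * real DIM('b) + 4) * \<theta> Z = 0"
    unfolding 1 2 by (simp add: algebra_simps)
  then show "\<theta> Z = 0" by simp
qed

lemma class34_zero:
  assumes "class3 z" "class4 z" and dim: "DIM('b) > 4"
  shows "z X Y Z = 0"
proof (rule class3_zero[OF assms(1)])
  fix \<theta> Z assume "\<And>Z. tr z Z = (real DIM('b) - 2) * \<theta> Z"
  from this[of Z] show "\<theta> Z = 0"
    using assms(2) dim by (simp add: class4_def)
qed

text \<open>\<open>alt\<close> removes the contribution of \<open>x\<close> to \<open>z\<close> and
  multiplies that of \<open>y\<close> by 6. Hence \<open>tr (alt z)\<close> is 0 if \<open>y\<close>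
  is trace-free and \<open>6 * tr z\<close> if \<open>x\<close> is; neither fits the traces of a
  nonzero \<open>sform\<close>.\<close>

lemma class3_dep_zero:
  assumes d: "dep x y z" and x: "class1 x" and y: "class2 y" and "class4 x \<or> class4 y"
    and z: "class3 z" and dim: "DIM('b) > 4"
  shows "z X Y Z = 0"
proof (rule class3_zero[OF z])
  fix \<theta> Z assume 1: "\<And>Z. tr (alt z) Z = (4 * real DIM('b) - 16) * \<theta> Z"
    and 2: "\<And>Z. tr z Z = (real DIM('b) - 2) * \<theta> Z"
  obtain A B s t where AB: "A \<in> {I, J, K}" "B \<in> {I, J, K}"
    and z: "\<And>X Y Z. z X Y Z = s * x (A X) Y Z + t * y (B X) Y Z"
    using d unfolding dep_def by blast
  have q: "qten x" "qten y" using x y by (auto simp: class1_def class2_def)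
  have t: "tr z Z = s * tr x (A Z) + t * tr y (B Z)"
    by (rule dep_alt(2)[of x y A B z s t, OF q AB z])
  have "alt z X Y Z = 6 * (0 * x (A X) Y Z + t * y (B X) Y Z)" for X Y Z
    using x y by (simp add: dep_alt(1)[of x y A B z s t, OF q AB z] class1_def class2_def)
  then have "tr (alt z) Z = 6 * tr (\<lambda>X Y Z. 0 * x (A X) Y Z + t * y (B X) Y Z) Z"
    by (simp add: tr_def sum_distrib_left)
  also have "\<dots> = 6 * (t * tr y (B Z))"
    by (subst dep_alt(2)[of x y A B _ 0 t, OF q AB]) auto
  finally have a: "tr (alt z) Z = 6 * (t * tr y (B Z))" .
  from assms(4) show "\<theta> Z = 0"
  proof
    assume "class4 y"
    then show ?thesis using a dim by (simp add: 1 class4_def)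
  next
    assume "class4 x"
    then have "tr (alt z) Z = 6 * tr z Z" using a t by (simp add: class4_def)
    then have "(2 * real DIM('b) + 4) * \<theta> Z = 0"
      unfolding 1 2 by (simp add: algebra_simps)
    then show ?thesis by simp
  qed
qed

end

section \<open>Compatible triples of types\<close>

text \<open>An absent index stands for a vanishing component. The implications appear in the order
  of the facts \<open>1\<close> to \<open>9\<close> in the proof of
  \<open>config_compatible\<close>.\<close>

definition compatible :: "nat set \<Rightarrow> nat set \<Rightarrow> nat set \<Rightarrow> bool" where
  "compatible a b c \<longleftrightarrow>
     (1 \<notin> a \<longrightarrow> 1 \<notin> b \<longrightarrow> 1 \<notin> c) \<and>
     (2 \<notin> a \<longrightarrow> 2 \<notin> b \<longrightarrow> 2 \<notin> c) \<and>
     (1 \<notin> a \<longrightarrow> 2 \<notin> a \<longrightarrow> 3 \<notin> b \<longrightarrow> 3 \<notin> c) \<and>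
     (1 \<notin> a \<longrightarrow> 2 \<notin> a \<longrightarrow> 4 \<notin> b \<longrightarrow> 4 \<notin> c) \<and>
     (1 \<notin> a \<longrightarrow> 3 \<notin> b \<longrightarrow> 3 \<notin> c \<longrightarrow> 2 \<notin> a) \<and>
     (2 \<notin> a \<longrightarrow> 3 \<notin> b \<longrightarrow> 3 \<notin> c \<longrightarrow> 1 \<notin> a) \<and>
     (3 \<notin> a \<longrightarrow> 4 \<notin> a \<longrightarrow> 3 \<notin> b \<longrightarrow> 4 \<notin> b \<longrightarrow> 1 \<notin> c) \<and>
     (1 \<notin> a \<longrightarrow> 3 \<notin> a \<longrightarrow> 4 \<notin> a \<longrightarrow> 2 \<notin> b \<longrightarrow> 3 \<notin> b \<longrightarrow> 4 \<notin> c \<longrightarrow> 4 \<notin> b) \<and>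
     (1 \<notin> a \<longrightarrow> 3 \<notin> a \<longrightarrow> 2 \<notin> b \<longrightarrow> 3 \<notin> b \<longrightarrow> 4 \<notin> b \<longrightarrow> 4 \<notin> c \<longrightarrow> 4 \<notin> a)"

definition compatible_sym :: "nat set \<Rightarrow> nat set \<Rightarrow> nat set \<Rightarrow> bool" where
  "compatible_sym a b c \<longleftrightarrow> compatible a b c \<and> compatible b c a \<and> compatible c a b \<and>
     compatible b a c \<and> compatible a c b \<and> compatible c b a"

text \<open>An index is absent from a union exactly if it is absent from every member, and each
  implication derives an absence from absences. So relations valid at each point pass to the types
  of the manifold.\<close>

lemma compatible_Union:
  assumes "\<And>x. x \<in> S \<Longrightarrow> compatible (a x) (b x) (c x)"
  shows "compatible (\<Union>x\<in>S. a x) (\<Union>x\<in>S. b x) (\<Union>x\<in>S. c x)"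
  using assms unfolding compatible_def UN_iff by blast

lemma compatible_sym_Union:
  assumes "\<And>x. x \<in> S \<Longrightarrow> compatible_sym (a x) (b x) (c x)"
  shows "compatible_sym (\<Union>x\<in>S. a x) (\<Union>x\<in>S. b x) (\<Union>x\<in>S. c x)"
  using assms unfolding compatible_sym_def by (simp add: compatible_Union)

fun pairs :: "'a list \<Rightarrow> ('a \<times> 'a) list" where
  "pairs [] = []"
| "pairs (x # xs) = map (Pair x) (x # xs) @ pairs xs"

fun triples :: "'a list \<Rightarrow> ('a \<times> 'a \<times> 'a) list" where
  "triples [] = []"
| "triples (x # xs) = map (Pair x) (pairs (x # xs)) @ triples xs"

lemma pairs_complete:
  "a \<in> set xs \<Longrightarrow> b \<in> set xs \<Longrightarrow> (a, b) \<in> set (pairs xs) \<or> (b, a) \<in> set (pairs xs)"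
  by (induction xs) auto

lemma triples_complete:
  assumes "a \<in> set xs" "b \<in> set xs" "c \<in> set xs"
  shows "(a, b, c) \<in> set (triples xs) \<or> (a, c, b) \<in> set (triples xs) \<or> (b, a, c) \<in> set (triples xs)
    \<or> (b, c, a) \<in> set (triples xs) \<or> (c, a, b) \<in> set (triples xs) \<or> (c, b, a) \<in> set (triples xs)"
  using assms
proof (induction xs)
  case (Cons x xs)
  have p: "(d, e) \<in> set (pairs (x # xs)) \<or> (e, d) \<in> set (pairs (x # xs))"
    if "d \<in> set (x # xs)" "e \<in> set (x # xs)" for d e
    using pairs_complete[OF that] .
  have t: "(x, d, e) \<in> set (triples (x # xs)) \<or> (x, e, d) \<in> set (triples (x # xs))"
    if "d \<in> set (x # xs)" "e \<in> set (x # xs)" for d e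
    using p[OF that] by (simp del: pairs.simps) blast
  have "a \<in> set xs \<and> b \<in> set xs \<and> c \<in> set xs \<or> x = a \<or> x = b \<or> x = c"
    using Cons.prems by auto
  then show ?case
  proof (elim disjE)
    assume "a \<in> set xs \<and> b \<in> set xs \<and> c \<in> set xs"
    then show ?thesis
      using Cons.IH by (simp del: pairs.simps) blast
  qed (use t[OF Cons.prems(1,2)] t[OF Cons.prems(1,3)] t[OF Cons.prems(2,3)] in blast)+
qed simp

section \<open>Boolean encoding and count of the compatible triples\<close>

type_synonym code = "bool \<times> bool \<times> bool \<times> bool"

fun decode :: "code \<Rightarrow> nat set" where
  "decode (p, q, r, s) = {i. i = 1 \<and> p \<or> i = 2 \<and> q \<or> i = 3 \<and> r \<or> i = 4 \<and> s}"

text \<open>The nine implications as clauses; the fifth and sixth merge into \<open>a1 = a2\<close>,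
  the last two into \<open>a4 = b4\<close>.\<close>

fun compatible_code :: "code \<Rightarrow> code \<Rightarrow> code \<Rightarrow> bool" where
  "compatible_code (a1, a2, a3, a4) (b1, b2, b3, b4) (c1, c2, c3, c4) \<longleftrightarrow>
     (a1 \<or> b1 \<or> \<not> c1) \<and> (a2 \<or> b2 \<or> \<not> c2) \<and>
     (a1 \<or> a2 \<or> ((b3 \<or> \<not> c3) \<and> (b4 \<or> \<not> c4))) \<and>
     (b3 \<or> c3 \<or> a1 = a2) \<and>
     (a3 \<or> b3 \<or> ((a4 \<or> b4 \<or> \<not> c1) \<and>
       (a1 \<or> b2 \<or> c4 \<or> a4 = b4)))"

definition all_codes :: "code list" where
  "all_codes = List.product [False, True] (List.product [False, True] (List.product [False, True] [False, True]))"

definition compatible_sym_code where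
  "compatible_sym_code a b c \<longleftrightarrow> compatible_code a b c \<and> compatible_code b c a \<and> compatible_code c a b \<and>
     compatible_code b a c \<and> compatible_code a c b \<and> compatible_code c b a"

lemma mem_decode:
  "1 \<in> decode (p, q, r, s) \<longleftrightarrow> p" "2 \<in> decode (p, q, r, s) \<longleftrightarrow> q"
  "3 \<in> decode (p, q, r, s) \<longleftrightarrow> r" "4 \<in> decode (p, q, r, s) \<longleftrightarrow> s"
  by auto

lemma compatible_decode:
  "compatible (decode a) (decode b) (decode c) \<longleftrightarrow> compatible_code a b c"
  by (cases a; cases b; cases c; simp only: compatible_def mem_decode compatible_code.simps) blast

lemma compatible_sym_decode:
  "compatible_sym (decode a) (decode b) (decode c) \<longleftrightarrow> compatible_sym_code a b c"
  by (simp add: compatible_sym_def compatible_sym_code_def compatible_decode)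

fun compatible_codes :: "code list \<Rightarrow> (code \<times> code \<times> code) list" where
  "compatible_codes [] = []"
| "compatible_codes (x # xs) =
     map (Pair x) (filter (\<lambda>(b, c). compatible_sym_code x b c) (pairs (x # xs))) @ compatible_codes xs"

lemma set_compatible_codes:
  "set (compatible_codes xs) = {(a, b, c) \<in> set (triples xs). compatible_sym_code a b c}"
  by (induction xs) (auto simp del: pairs.simps)

text \<open>Counting without building the list of triples keeps the terms small during simplification.\<close>

fun count_codes :: "code list \<Rightarrow> nat" where
  "count_codes [] = 0"
| "count_codes (x # xs) =
     length (filter (\<lambda>(b, c). compatible_sym_code x b c) (pairs (x # xs))) + count_codes xs"

lemma length_compatible_codes: "length (compatible_codes xs) = count_codes xs"
  by (induction xs) (simp_all del: pairs.simps)

lemma count_all_codes: "count_codes all_codes = 167"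
  by code_simp

lemma set_all_codes: "set all_codes = UNIV"
  by (simp only: all_codes_def set_product list.set UNIV_bool[symmetric] UNIV_Times_UNIV)

lemma decode_surj: "a \<subseteq> {1..4} \<Longrightarrow> \<exists>p. a = decode p"
proof
  assume a: "a \<subseteq> {1..4}"
  show "a = decode (1 \<in> a, 2 \<in> a, 3 \<in> a, 4 \<in> a)"
    using a by (auto simp: numeral_eq_Suc le_Suc_eq subset_iff)
qed

lemma compatible_multisets:
  "finite {{#a, b, c#} | a b c. a \<subseteq> {1..4} \<and> b \<subseteq> {1..4} \<and> c \<subseteq> {1..4} \<and> compatible_sym a b c}"
  "card {{#a, b, c#} | a b c. a \<subseteq> {1..4} \<and> b \<subseteq> {1..4} \<and> c \<subseteq> {1..4} \<and> compatible_sym a b c} \<le> 167"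
proof -
  let ?S = "{{#a, b, c#} | a b c. a \<subseteq> {1..4} \<and> b \<subseteq> {1..4} \<and> c \<subseteq> {1..4} \<and> compatible_sym a b c}"
  let ?f = "\<lambda>(a, b, c). {#decode a, decode b, decode c#}"
  have sub: "?S \<subseteq> ?f ` set (compatible_codes all_codes)"
  proof clarify
    fix a b c :: "nat set" assume "a \<subseteq> {1..4}" "b \<subseteq> {1..4}" "c \<subseteq> {1..4}" and s: "compatible_sym a b c"
    then obtain p q r where d: "a = decode p" "b = decode q" "c = decode r"
      using decode_surj by metis
    have pqr: "p \<in> set all_codes" "q \<in> set all_codes" "r \<in> set all_codes"
      by (simp_all add: set_all_codes)
    have mem: "{#a, b, c#} \<in> ?f ` set (compatible_codes all_codes)"
      if "(x, y, z) \<in> set (triples all_codes)" "compatible_sym_code x y z"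
        "{#a, b, c#} = {#decode x, decode y, decode z#}" for x y z
      using that by (force simp: set_compatible_codes)
    have "compatible_sym_code p q r" using s by (simp add: d compatible_sym_decode)
    \<comment> \<open>The list holds each unordered triple in some order; as
      \<open>compatible_sym_code\<close> is invariant under permutations, whichever order occurs
      passes the filter.\<close>
    then show "{#a, b, c#} \<in> ?f ` set (compatible_codes all_codes)"
      using triples_complete[OF pqr] unfolding compatible_sym_code_def
      by (elim disjE) (rule mem, assumption, simp add: compatible_sym_code_def, simp add: d add_mset_commute)+
  qed
  show "finite ?S" using sub by (rule finite_subset) simp
  have "card ?S \<le> card (?f ` set (compatible_codes all_codes))" using sub by (intro card_mono) simp_all
  also have "\<dots> \<le> length (compatible_codes all_codes)" by (meson card_image_le card_length finite_set le_trans)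
  finally show "card ?S \<le> 167" by (simp add: length_compatible_codes count_all_codes)
qed

section \<open>Pointwise proof of the nine implications\<close>

context quaternionic_form
begin

text \<open>Only the incidences between the six tensors matter, and these are symmetric under
  simultaneous permutations of the indices; so one order of \<open>I\<close>, \<open>J\<close>, \<open>K\<close> suffices below.\<close>

definition config where
  "config u1 u2 u3 v1 v2 v3 \<longleftrightarrow> (\<forall>w\<in>{u1, u2, u3, v1, v2, v3}. qten w) \<and>
     dep u1 u2 u3 \<and> dep u2 u3 u1 \<and> dep u3 u1 u2 \<and>
     dep u1 v2 v3 \<and> dep u1 v3 v2 \<and> dep v2 v3 u1 \<and>
     dep u2 v3 v1 \<and> dep u2 v1 v3 \<and> dep v3 v1 u2 \<and>
     dep u3 v1 v2 \<and> dep u3 v2 v1 \<and> dep v1 v2 u3"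

lemma config_rotate: "config u1 u2 u3 v1 v2 v3 \<Longrightarrow> config u2 u3 u1 v2 v3 v1"
  unfolding config_def by blast

lemma config_swap: "config u1 u2 u3 v1 v2 v3 \<Longrightarrow> config u2 u1 u3 v2 v1 v3"
  unfolding config_def by (blast intro: dep_sym)

definition class_set :: "('b \<Rightarrow> 'b \<Rightarrow> 'b \<Rightarrow> real) \<Rightarrow> ('b \<Rightarrow> 'b \<Rightarrow> 'b \<Rightarrow> real) \<Rightarrow> nat set" where
  "class_set u v = {i. i = 1 \<and> \<not> class1 u \<or> i = 2 \<and> \<not> class2 u \<or> i = 3 \<and> \<not> class3 v \<or> i = 4 \<and> \<not> class4 v}"

lemma class_set_iff [simp]: "1 \<notin> class_set u v \<longleftrightarrow> class1 u" "2 \<notin> class_set u v \<longleftrightarrow> class2 u"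
  "3 \<notin> class_set u v \<longleftrightarrow> class3 v" "4 \<notin> class_set u v \<longleftrightarrow> class4 v"
  by (simp_all add: class_set_def)

lemma class12_zero: "class1 u \<Longrightarrow> class2 u \<Longrightarrow> u X Y Z = 0"
  by (simp add: class1_def class2_def)

lemma config_compatible:
  assumes c: "config u1 u2 u3 v1 v2 v3" and dim: "DIM('b) > 4"
  shows "compatible (class_set u1 v1) (class_set u2 v2) (class_set u3 v3)"
proof -
  have q: "qten u1" "qten u2" "qten u3" "qten v1" "qten v2" "qten v3"
    and d: "dep u1 u2 u3" "dep u1 v2 v3" "dep v2 v3 u1" "dep v3 v1 u2" "dep v1 v2 u3"
      "dep u3 v1 v2" "dep u3 v2 v1"
    using c unfolding config_def by simp_all
  note z = class_zero
  have 1: "class1 u3" if "class1 u1" "class1 u2" using dep_class1[OF d(1) that q(3)] .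
  have 2: "class2 u3" if "class2 u1" "class2 u2" using dep_class2[OF d(1) that q(3)] .
  have 3: "class3 v3" if "class1 u1" "class2 u1" "class3 v2"
    using dep_class3[OF d(2) z(3)[OF q(1) class12_zero[OF that(1,2)]] that(3) q(6)] .
  have 4: "class4 v3" if "class1 u1" "class2 u1" "class4 v2"
    using dep_class4[OF d(2) z(4)[OF q(1) class12_zero[OF that(1,2)]] that(3) q(6)] .
  have u1: "class3 u1" if "class3 v2" "class3 v3" using dep_class3[OF d(3) that q(1)] .
  have u3: "class3 u3" if "class3 v1" "class3 v2" using dep_class3[OF d(5) that q(3)] .
  have 5: "class2 u1" if "class1 u1" "class3 v2" "class3 v3"
    by (rule z(2)[OF q(1) class31_zero[OF u1[OF that(2,3)] that(1) dim]])
  have 6: "class1 u1" if "class2 u1" "class3 v2" "class3 v3"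
    by (rule z(1)[OF q(1) class32_zero[OF u1[OF that(2,3)] that(1)]])
  \<comment> \<open>Here \<open>u3\<close> vanishes altogether. Recording \<open>class1\<close>
    suffices: the fifth implication, with the third structure in front, then yields
    \<open>class2\<close>.\<close>
  have 7: "class1 u3" if "class3 v1" "class4 v1" "class3 v2" "class4 v2"
    by (rule z(1)[OF q(3) dep_zero[OF d(5) q(4,5) class34_zero[OF that(1,2) dim]
          class34_zero[OF that(3,4) dim]]])
  \<comment> \<open>As \<open>v1\<close> vanishes, \<open>u2\<close> inherits a zero trace from
    \<open>v3\<close>. Then \<open>u3\<close> is a combination of \<open>u1\<close> and
    \<open>u2\<close> and also an \<open>sform\<close>, hence zero, and \<open>v2\<close> depends on
    \<open>u3\<close> and \<open>v1\<close>. Fact 9 exchanges the roles of \<open>v1\<close> and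
    \<open>v2\<close>, with \<open>u1\<close> as the trace-free tensor.\<close>
  have 8: "class4 v2" if "class1 u1" "class3 v1" "class4 v1" "class2 u2" "class3 v2" "class4 v3"
  proof -
    have v1: "v1 X Y Z = 0" for X Y Z by (rule class34_zero[OF that(2,3) dim])
    have "class4 u2" by (rule dep_class4[OF d(4) that(6,3) q(2)])
    then have "u3 X Y Z = 0" for X Y Z
      using class3_dep_zero[OF d(1) that(1,4) _ u3[OF that(2,5)] dim] by blast
    then show ?thesis by (intro z(4)[OF q(5)] dep_zero[OF d(6) q(3,4) _ v1])
  qed
  have 9: "class4 v1" if "class1 u1" "class3 v1" "class2 u2" "class3 v2" "class4 v2" "class4 v3"
  proof -
    have v2: "v2 X Y Z = 0" for X Y Z by (rule class34_zero[OF that(4,5) dim])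
    have "class4 u1" by (rule dep_class4[OF d(3) that(5,6) q(1)])
    then have "u3 X Y Z = 0" for X Y Z
      using class3_dep_zero[OF d(1) that(1,3) _ u3[OF that(2,4)] dim] by blast
    then show ?thesis by (intro z(4)[OF q(4)] dep_zero[OF d(7) q(3,5) _ v2])
  qed
  show ?thesis
    unfolding compatible_def class_set_iff using 1 2 3 4 5 6 7 8 9 by blast
qed

lemma config_compatible_sym:
  assumes "config u1 u2 u3 v1 v2 v3" and dim: "DIM('b) > 4"
  shows "compatible_sym (class_set u1 v1) (class_set u2 v2) (class_set u3 v3)"
  unfolding compatible_sym_def
  using assms(1) by (blast intro: config_compatible[OF _ dim] config_rotate config_swap)

text \<open>\<open>F\<close> and \<open>G\<close> are -2 and -6 times the anti-invariant and skew
  parts of \<open>b\<close>, and both are built with \<open>I\<close> and \<open>J\<close> from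
  \<open>u\<close> and \<open>alt u\<close>. The formulas \<open>uF\<close> and \<open>AG\<close>
  invert these passages, so conditions transfer both ways; \<open>inv_part\<close> and
  \<open>v\<close> are related in the same manner.\<close>

lemma GH_link:
  assumes \<beta>: "qten \<beta>" and \<gamma>: "qten \<gamma>" and b: "b \<in> GH_space I"
    and b_def: "\<And>X Y Z. b X Y Z = \<beta> X (K Y) Z - \<gamma> X (J Y) Z"
    and u_def: "\<And>X Y Z. u X Y Z = \<gamma> X Y Z + \<beta> (I X) Y Z"
    and v_def: "\<And>X Y Z. v X Y Z = \<gamma> X Y Z - \<beta> (I X) Y Z"
    and dim: "DIM('b) > 2"
  shows "qten u" "qten v"
    "{i \<in> {1..4}. \<exists>X Y Z. GH_component h I i b X Y Z \<noteq> 0} = class_set u v"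
proof -
  note S\<beta> = qten_linear_simps[OF \<beta>] qten_shift[OF \<beta>] and S\<gamma> = qten_linear_simps[OF \<gamma>] qten_shift[OF \<gamma>]
  have "u X Y Z = u X Z Y" "v X Y Z = v X Z Y" for X Y Z
    using qtenD(3)[OF \<beta>, of "I X" Y Z] qtenD(3)[OF \<gamma>, of X Y Z] by (simp_all add: u_def v_def)
  then show u: "qten u" and v: "qten v"
    by (auto intro!: qtenI simp: u_def v_def S\<beta> S\<gamma> algebra_simps)
  note Su = qten_linear_simps[OF u] qten_shift[OF u] and Sv = qten_linear_simps[OF v] qten_shift[OF v]
  define F where "F X Y Z = u X (J Y) Z + u (I X) (K Y) Z" for X Y Z
  define G where "G X Y Z = F X Y Z + F Y Z X + F Z X Y" for X Y Z
  have anti_part: "I.anti_part b X Y Z = - F X Y Z / 2" for X Y Z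
    by (simp add: I.anti_part_def F_def b_def u_def S\<beta> S\<gamma>)
  have skew_part: "I.skew_part b X Y Z = - G X Y Z / 6" for X Y Z
    by (simp add: I.skew_part_def G_def anti_part)
  have inv_part: "I.inv_part b X Y Z = (v (I X) (K Y) Z - v X (J Y) Z) / 2" for X Y Z
    by (simp add: I.inv_part_def b_def v_def S\<beta> S\<gamma>)
  have uF: "u X Y Z = (F X Y (J Z) - F X (J Y) Z) / 2" for X Y Z
    by (simp add: F_def Su)
  have sy: "u X (J Z) Y = - u X (J Y) Z" "u X (I Z) Y = - u X (I Y) Z" "u X (K Z) Y = - u X (K Y) Z"
     for X Y Z
    using qtenD(3)[OF u, of X "J Z" Y] qtenD(3)[OF u, of X "I Z" Y] qtenD(3)[OF u, of X "K Z" Y]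
    by (simp_all add: Su)
  have GA: "G X Y Z = (alt u X (J Y) Z + alt u (I X) (K Y) Z) / 2" for X Y Z
    using sy[of X Y Z] sy[of Y X Z] sy[of Z X Y] sy[of "I X" Y Z] sy[of "I Y" X Z] sy[of "I Z" X Y]
       sy[of "J X" Y Z] sy[of "J Y" X Z] sy[of "J Z" X Y] sy[of "K X" Y Z] sy[of "K Y" X Z] sy[of "K Z" X Y]
    by (simp add: G_def F_def alt_def Su)
  have AG: "alt u X Y Z = G X Y (J Z) - G X (J Y) Z" for X Y Z
    using sy[of X Y Z] sy[of Y X Z] sy[of Z X Y] sy[of "I X" Y Z] sy[of "I Y" X Z] sy[of "I Z" X Y]
      sy[of "J X" Y Z] sy[of "J Y" X Z] sy[of "J Z" X Y] sy[of "K X" Y Z] sy[of "K Y" X Z] sy[of "K Z" X Y]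
      qtenD(3)[OF u, of X Z Y] qtenD(3)[OF u, of Y Z X] qtenD(3)[OF u, of Z Y X]
    by (simp add: G_def F_def alt_def Su)
  have 1: "(\<forall>X Y Z. I.skew_part b X Y Z = 0) \<longleftrightarrow> class1 u"
  proof
    assume "\<forall>X Y Z. I.skew_part b X Y Z = 0"
    then show "class1 u" using u by (simp add: class1_def AG skew_part)
  next
    assume "class1 u"
    then show "\<forall>X Y Z. I.skew_part b X Y Z = 0" by (simp add: class1_def GA skew_part)
  qed
  have 2: "(\<forall>X Y Z. I.anti_part b X Y Z = I.skew_part b X Y Z) \<longleftrightarrow> class2 u"
  proof
    assume "\<forall>X Y Z. I.anti_part b X Y Z = I.skew_part b X Y Z"
    then have "G X Y Z = 3 * F X Y Z" for X Y Z by (simp add: anti_part skew_part)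
    then have "alt u X Y Z = 6 * u X Y Z" for X Y Z by (simp add: AG uF)
    then show "class2 u" using u by (simp add: class2_def)
  next
    assume "class2 u"
    then show "\<forall>X Y Z. I.anti_part b X Y Z = I.skew_part b X Y Z"
      by (simp add: anti_part skew_part GA class2_def F_def field_simps)
  qed
  have 3: "(\<exists>\<beta>. linear \<beta> \<and> (\<forall>X Y Z. I.inv_part b X Y Z = I.w4 \<beta> X Y Z)) \<longleftrightarrow> class3 v"
  proof
    assume "\<exists>\<beta>. linear \<beta> \<and> (\<forall>X Y Z. I.inv_part b X Y Z = I.w4 \<beta> X Y Z)"
    then obtain \<eta> where \<eta>: "linear \<eta>" "\<And>X Y Z. I.inv_part b X Y Z = I.w4 \<eta> X Y Z" by blast
    have "v X Y Z = I.inv_part b X (J Y) Z - I.inv_part b X Y (J Z)" for X Y Z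
      by (simp add: inv_part Sv field_simps)
    then have "v X Y Z = sform (\<lambda>x. - \<eta> (J x)) X Y Z" for X Y Z
      by (simp add: \<eta>(2) I.w4_def sform_def linear_neg[OF \<eta>(1)])
    then show "class3 v"
      using v linear_compose_neg[OF linear_sform_arg(2)[OF \<eta>(1)]] by (auto simp: class3_def)
  next
    assume "class3 v"
    then obtain \<theta> where \<theta>: "linear \<theta>" "\<And>X Y Z. v X Y Z = sform \<theta> X Y Z"
      by (auto simp: class3_def)
    have "I.inv_part b X Y Z = I.w4 (\<lambda>x. \<theta> (J x)) X Y Z" for X Y Z
      by (simp add: inv_part \<theta>(2) sform_def I.w4_def linear_neg[OF \<theta>(1)] I.skew J.skew K.skew)
    then show "\<exists>\<beta>. linear \<beta> \<and> (\<forall>X Y Z. I.inv_part b X Y Z = I.w4 \<beta> X Y Z)"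
      using linear_sform_arg(2)[OF \<theta>(1)] by blast
  qed
  \<comment> \<open>Changing the basis from \<open>e\<close> to \<open>I e\<close> gives the sign
    that matches the minus sign in \<open>v\<close>; with the plus sign of \<open>u\<close> the
    trace of \<open>b\<close> would not result.\<close>
  have "(\<Sum>e\<in>onb. \<beta> (I e) e Z) = - (\<Sum>e\<in>onb. \<beta> e (I e) Z)" for Z
    using tr_comp(1)[OF \<beta>, of Z] by (simp add: tr_def S\<beta> sum_negf)
  then have "tr v Z = (\<Sum>e\<in>onb. \<beta> e (I e) Z + \<gamma> e e Z)" for Z
    by (simp add: tr_def v_def sum.distrib sum_subtractf)
  then have t: "tr v Z = - (\<Sum>e\<in>onb. b e e (J Z))" for Z
    by (simp add: b_def S\<beta> S\<gamma> add.commute flip: sum_negf)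
  have t': "(\<Sum>e\<in>onb. b e e Z) = tr v (J Z)" for Z
    using t[of "J Z"] by (simp add: I.GH_space_simps[OF b] sum_negf)
  have 4: "(\<forall>Z. (\<Sum>e\<in>onb. b e e Z) = 0) \<longleftrightarrow> class4 v"
  proof
    assume "\<forall>Z. (\<Sum>e\<in>onb. b e e Z) = 0"
    then show "class4 v" using v by (simp add: class4_def t)
  next
    assume "class4 v"
    then show "\<forall>Z. (\<Sum>e\<in>onb. b e e Z) = 0" by (simp add: class4_def t')
  qed
  note c = I.component_1_zero_iff[OF b dim] I.component_2_zero_iff[OF b dim]
    I.component_3_zero_iff[OF b dim] I.component_4_zero_iff[OF b dim]
  have N: "{i \<in> {1..4}. P i} = {i. i = 1 \<and> P 1 \<or> i = 2 \<and> P 2 \<or> i = 3 \<and> P 3 \<or> i = 4 \<and> P 4}"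
    for P :: "nat \<Rightarrow> bool"
    by (auto simp: numeral_eq_Suc le_Suc_eq)
  have "(\<exists>X Y Z. GH_component h I 1 b X Y Z \<noteq> 0) \<longleftrightarrow> \<not> class1 u"
    "(\<exists>X Y Z. GH_component h I 2 b X Y Z \<noteq> 0) \<longleftrightarrow> \<not> class2 u"
    "(\<exists>X Y Z. GH_component h I 3 b X Y Z \<noteq> 0) \<longleftrightarrow> \<not> class3 v"
    "(\<exists>X Y Z. GH_component h I 4 b X Y Z \<noteq> 0) \<longleftrightarrow> \<not> class4 v"
    using c[unfolded 1 2 3 4] by blast+
  then show "{i \<in> {1..4}. \<exists>X Y Z. GH_component h I i b X Y Z \<noteq> 0} = class_set u v"
    unfolding N class_set_def by simp
qed

text \<open>Each of the forms alone yields two invariant tensors, by averaging over the quaternion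
  it is twisted with. The point is that neighbouring forms share one of them.\<close>

lemma quaternionic_decomposition:
  assumes bI: "bI \<in> GH_space I" and bJ: "bJ \<in> GH_space J" and bK: "bK \<in> GH_space K"
    and rel: "\<And>X Y Z. bK X Y Z = bI X Y (J Z) - bJ X (I Y) Z"
  obtains \<alpha> \<beta> \<gamma> where "qten \<alpha>" "qten \<beta>" "qten \<gamma>"
    "\<And>X Y Z. bI X Y Z = \<beta> X (K Y) Z - \<gamma> X (J Y) Z"
    "\<And>X Y Z. bJ X Y Z = \<gamma> X (I Y) Z - \<alpha> X (K Y) Z"
    "\<And>X Y Z. bK X Y Z = \<alpha> X (J Y) Z - \<beta> X (I Y) Z"
proof -
  note SI = I.GH_space_simps[OF bI] I.GH_spaceD(5)[OF bI, symmetric]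
  note SJ = J.GH_space_simps[OF bJ] J.GH_spaceD(5)[OF bJ, symmetric]
  define \<gamma> where "\<gamma> X Y Z = (bI X (J Y) Z - bI X Y (J Z)) / 2" for X Y Z
  define \<beta> where "\<beta> X Y Z = (bI X Y (K Z) - bI X (K Y) Z) / 2" for X Y Z
  define \<alpha> where "\<alpha> X Y Z = (bJ X (K Y) Z - bJ X Y (K Z)) / 2" for X Y Z
  \<comment> \<open>This is the skew-symmetry of \<open>bK\<close>, written out through
    \<open>rel\<close>: the tensor extracted from \<open>bI\<close> is also the one extracted from
    \<open>bJ\<close>.\<close>
  have \<gamma>J: "\<gamma> X Y Z = (bJ X Y (I Z) - bJ X (I Y) Z) / 2" for X Y Z
    using K.GH_spaceD(3)[OF bK, of X Y Z] I.GH_spaceD(3)[OF bI, of X Z "J Y"]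
      J.GH_spaceD(3)[OF bJ, of X "I Z" Y] unfolding rel \<gamma>_def by argo
  have IK: "bI X Y (K Z) = bI X (I Y) (J Z)" and JK: "bJ X Y (K Z) = - bJ X (J Y) (I Z)" for X Y Z
    using I.GH_spaceD(5)[OF bI, of X Y "J Z"] J.GH_spaceD(5)[OF bJ, of X Y "I Z"]
    by (simp_all add: J.GH_space_simps[OF bJ])
  show thesis
  proof (rule that[of \<alpha> \<beta> \<gamma>])
    show "qten \<gamma>"
    proof (rule qtenI)
      show "\<gamma> X Y Z = \<gamma> X Z Y" for X Y Z
        using I.GH_spaceD(3)[OF bI, of X "J Y" Z] I.GH_spaceD(3)[OF bI, of X Y "J Z"]
        by (simp add: \<gamma>_def)
    qed (simp_all add: \<gamma>_def SI IK field_simps)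
    show "qten \<beta>"
    proof (rule qtenI)
      show "\<beta> X Y Z = \<beta> X Z Y" for X Y Z
        using I.GH_spaceD(3)[OF bI, of X "K Y" Z] I.GH_spaceD(3)[OF bI, of X Y "K Z"]
        by (simp add: \<beta>_def)
    qed (simp_all add: \<beta>_def SI IK field_simps)
    show "qten \<alpha>"
    proof (rule qtenI)
      show "\<alpha> X Y Z = \<alpha> X Z Y" for X Y Z
        using J.GH_spaceD(3)[OF bJ, of X "K Y" Z] J.GH_spaceD(3)[OF bJ, of X Y "K Z"]
        by (simp add: \<alpha>_def)
    qed (simp_all add: \<alpha>_def SJ JK field_simps)
    show "bI X Y Z = \<beta> X (K Y) Z - \<gamma> X (J Y) Z" for X Y Z
      by (simp add: \<beta>_def \<gamma>_def SI IK field_simps)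
    show "bJ X Y Z = \<gamma> X (I Y) Z - \<alpha> X (K Y) Z" for X Y Z
      by (simp add: \<alpha>_def \<gamma>J SJ JK field_simps)
    show "bK X Y Z = \<alpha> X (J Y) Z - \<beta> X (I Y) Z" for X Y Z
      using \<gamma>J[of X Y Z] unfolding rel \<gamma>_def by (simp add: \<alpha>_def \<beta>_def SI SJ IK JK field_simps)
  qed
qed

lemma types_compatible:
  assumes bI: "bI \<in> GH_space I" and bJ: "bJ \<in> GH_space J" and bK: "bK \<in> GH_space K"
    and rel: "\<And>X Y Z. bK X Y Z = bI X Y (J Z) - bJ X (I Y) Z"
    and dim: "DIM('b) > 4"
  shows "compatible_sym {i \<in> {1..4}. \<exists>X Y Z. GH_component h I i bI X Y Z \<noteq> 0}
    {i \<in> {1..4}. \<exists>X Y Z. GH_component h J i bJ X Y Z \<noteq> 0}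
    {i \<in> {1..4}. \<exists>X Y Z. GH_component h K i bK X Y Z \<noteq> 0}"
proof -
  obtain \<alpha> \<beta> \<gamma> where q: "qten \<alpha>" "qten \<beta>" "qten \<gamma>"
    and b: "\<And>X Y Z. bI X Y Z = \<beta> X (K Y) Z - \<gamma> X (J Y) Z"
    "\<And>X Y Z. bJ X Y Z = \<gamma> X (I Y) Z - \<alpha> X (K Y) Z"
    "\<And>X Y Z. bK X Y Z = \<alpha> X (J Y) Z - \<beta> X (I Y) Z"
    using quaternionic_decomposition[OF bI bJ bK rel] by blast
  have dim2: "DIM('b) > 2" using dim by simp
  define uI where "uI X Y Z = \<gamma> X Y Z + \<beta> (I X) Y Z" for X Y Z
  define vI where "vI X Y Z = \<gamma> X Y Z - \<beta> (I X) Y Z" for X Y Z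
  define uJ where "uJ X Y Z = \<alpha> X Y Z + \<gamma> (J X) Y Z" for X Y Z
  define vJ where "vJ X Y Z = \<alpha> X Y Z - \<gamma> (J X) Y Z" for X Y Z
  define uK where "uK X Y Z = \<beta> X Y Z + \<alpha> (K X) Y Z" for X Y Z
  define vK where "vK X Y Z = \<beta> X Y Z - \<alpha> (K X) Y Z" for X Y Z
  interpret JKI: quaternionic_form h J K I by (rule rotate)
  interpret KIJ: quaternionic_form h K I J by (rule JKI.rotate)
  note r = rotate_eqs(3) rotate_classes and r' = JKI.rotate_eqs(3) JKI.rotate_classes
  have cJ: "JKI.class_set u v = class_set u v" for u v
    unfolding JKI.class_set_def class_set_def r ..
  have cK: "KIJ.class_set u v = class_set u v" for u v
    unfolding KIJ.class_set_def class_set_def r' r ..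
  note lI = GH_link[OF q(2,3) bI b(1) uI_def vI_def dim2]
  note lJ = JKI.GH_link[unfolded r cJ, OF q(3,1) bJ b(2) uJ_def vJ_def dim2]
  note lK = KIJ.GH_link[unfolded r' r cK, OF q(1,2) bK b(3) uK_def vK_def dim2]
  note S = qten_linear_simps[OF q(1)] qten_linear_simps[OF q(2)] qten_linear_simps[OF q(3)]
  note defs = uI_def vI_def uJ_def vJ_def uK_def vK_def
  have depI: "dep x y z" if "A \<in> {I, J, K}" "B \<in> {I, J, K}"
    "\<And>X Y Z. z X Y Z = s * x (A X) Y Z + t * y (B X) Y Z" for x y z A B s t
    using that unfolding dep_def by blast
  \<comment> \<open>Two tensors of different structures share one of \<open>\<alpha>\<close>,
    \<open>\<beta>\<close>, \<open>\<gamma>\<close>; the translates and signs are chosen to cancel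
    it. Here \<open>\<gamma>\<close> drops out because \<open>J (K X) = I X\<close>.\<close>
  have "dep uI uJ uK" by (rule depI[of I K _ "-1" _ 1]) (simp_all add: defs S)
  moreover have "dep uJ uK uI" by (rule depI[of J I _ "-1" _ 1]) (simp_all add: defs S)
  moreover have "dep uK uI uJ" by (rule depI[of K J _ "-1" _ 1]) (simp_all add: defs S)
  moreover have "dep uI vJ vK" by (rule depI[of I K _ "-1" _ "-1"]) (simp_all add: defs S)
  moreover have "dep uI vK vJ" by (rule depI[of J K _ "-1" _ 1]) (simp_all add: defs S)
  moreover have "dep vJ vK uI" by (rule depI[of J I _ 1 _ 1]) (simp_all add: defs S)
  moreover have "dep uJ vK vI" by (rule depI[of J I _ "-1" _ "-1"]) (simp_all add: defs S)
  moreover have "dep uJ vI vK" by (rule depI[of K I _ "-1" _ 1]) (simp_all add: defs S)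
  moreover have "dep vK vI uJ" by (rule depI[of K J _ 1 _ 1]) (simp_all add: defs S)
  moreover have "dep uK vI vJ" by (rule depI[of K J _ "-1" _ "-1"]) (simp_all add: defs S)
  moreover have "dep uK vJ vI" by (rule depI[of I J _ "-1" _ 1]) (simp_all add: defs S)
  moreover have "dep vI vJ uK" by (rule depI[of I K _ 1 _ 1]) (simp_all add: defs S)
  ultimately have "config uI uJ uK vI vJ vK"
    using lI(1,2) lJ(1,2) lK(1,2) by (simp add: config_def)
  from config_compatible_sym[OF this dim] show ?thesis
    unfolding lI(3) lJ(3) lK(3) .
qed

end

section \<open>The Levi-Civita connection at a point\<close>

lemma derivative_family_linear:
  fixes T :: "'a::real_normed_vector \<Rightarrow> 'b::euclidean_space \<Rightarrow> 'c::real_normed_vector"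
  assumes S: "open S" "x \<in> S" and lin: "\<And>y. y \<in> S \<Longrightarrow> linear (T y)"
    and D: "\<And>v. ((\<lambda>y. T y v) has_derivative D v) (at x)"
  shows "linear (\<lambda>v. D v X)"
proof (rule linearI)
  fix u v
  have "((\<lambda>y. T y u + T y v) has_derivative (\<lambda>X. D u X + D v X)) (at x)"
    by (intro derivative_intros D)
  then have "((\<lambda>y. T y (u + v)) has_derivative (\<lambda>X. D u X + D v X)) (at x)"
    by (rule has_derivative_transform_within_open[OF _ S]) (simp add: lin linear_add)
  from has_derivative_unique[OF D this] show "D (u + v) X = D u X + D v X" by simp
next
  fix r v
  have "((\<lambda>y. r *\<^sub>R T y v) has_derivative (\<lambda>X. r *\<^sub>R D v X)) (at x)"
    by (intro derivative_intros D)
  then have "((\<lambda>y. T y (r *\<^sub>R v)) has_derivative (\<lambda>X. r *\<^sub>R D v X)) (at x)"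
    by (rule has_derivative_transform_within_open[OF _ S]) (simp add: lin linear_scale)
  from has_derivative_unique[OF D this] show "D (r *\<^sub>R v) X = r *\<^sub>R D v X" by simp
qed

text \<open>Product rule for a moving linear map applied to a moving vector. Expansion in
  \<open>Basis\<close> reduces it to products of scalars and vectors, so only derivatives of
  \<open>T\<close> at fixed vectors enter.\<close>

lemma has_derivative_linear_family:
  fixes T :: "'a::real_normed_vector \<Rightarrow> 'b::euclidean_space \<Rightarrow> 'c::real_normed_vector"
  assumes S: "open S" "x \<in> S" and lin: "\<And>y. y \<in> S \<Longrightarrow> linear (T y)"
    and D: "\<And>v. ((\<lambda>y. T y v) has_derivative D v) (at x)"
    and f: "(f has_derivative f') (at x)"
  shows "((\<lambda>y. T y (f y)) has_derivative (\<lambda>X. D (f x) X + T x (f' X))) (at x)"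
proof -
  have ex: "L v = (\<Sum>i\<in>Basis. (v \<bullet> i) *\<^sub>R L i)" if "linear L" for L :: "'b \<Rightarrow> 'c" and v
  proof -
    have "L v = L (\<Sum>i\<in>Basis. (v \<bullet> i) *\<^sub>R i)" by (simp add: euclidean_representation)
    then show ?thesis using that by (simp add: linear_sum linear_scale)
  qed
  have "((\<lambda>y. \<Sum>i\<in>Basis. (f y \<bullet> i) *\<^sub>R T y i) has_derivative
      (\<lambda>X. \<Sum>i\<in>Basis. (f x \<bullet> i) *\<^sub>R D i X + (f' X \<bullet> i) *\<^sub>R T x i)) (at x)"
    by (intro has_derivative_sum has_derivative_scaleR D has_derivative_inner_left f)
  also have "(\<lambda>X. \<Sum>i\<in>Basis. (f x \<bullet> i) *\<^sub>R D i X + (f' X \<bullet> i) *\<^sub>R T x i) =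
      (\<lambda>X. D (f x) X + T x (f' X))"
  proof
    fix X
    show "(\<Sum>i\<in>Basis. (f x \<bullet> i) *\<^sub>R D i X + (f' X \<bullet> i) *\<^sub>R T x i) = D (f x) X + T x (f' X)"
      unfolding sum.distrib
      by (simp only: ex[OF derivative_family_linear[OF S lin D], of "f x" X]
          ex[OF lin[OF S(2)], of "f' X"])
  qed
  finally show ?thesis
    by (rule has_derivative_transform_within_open[OF _ S]) (simp add: ex[OF lin, symmetric])
qed

locale metric_germ =
  fixes S :: "'b::euclidean_space set" and x :: 'b and G :: "'b \<Rightarrow> 'b \<Rightarrow> 'b \<Rightarrow> real"
  assumes S: "open S" "x \<in> S" and form: "\<And>y. y \<in> S \<Longrightarrow> inner_form (G y)"
    and diff: "(\<lambda>y. G y u v) differentiable (at x)"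
begin

sublocale inner_form "G x" using form S(2) by blast

definition dG where "dG X Y Z = frechet_derivative (\<lambda>y. G y Y Z) (at x) X"

lemma dG: "((\<lambda>y. G y Y Z) has_derivative (\<lambda>X. dG X Y Z)) (at x)"
  using diff unfolding dG_def frechet_derivative_works by simp

lemma linear_G: "y \<in> S \<Longrightarrow> linear (G y Y)" "y \<in> S \<Longrightarrow> linear (\<lambda>Y. G y Y Z)"
  using inner_form.bil[OF form] by (auto simp: bilinear_def)

lemma linear_dG: "linear (\<lambda>X. dG X Y Z)" "linear (\<lambda>Y. dG X Y Z)" "linear (\<lambda>Z. dG X Y Z)"
  using has_derivative_linear[OF dG] derivative_family_linear[OF S linear_G(1) dG]
    derivative_family_linear[OF S linear_G(2) dG] by auto

lemma dG_sym: "dG X Y Z = dG X Z Y"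
proof -
  have "((\<lambda>y. G y Z Y) has_derivative (\<lambda>X. dG X Y Z)) (at x)"
    by (rule has_derivative_transform_within_open[OF dG S]) (rule inner_form.sym[OF form])
  from has_derivative_unique[OF dG this] show ?thesis by metis
qed

text \<open>The Koszul formula for constant vector fields, whose brackets vanish.\<close>

definition koszul where "koszul X Y Z = (dG X Y Z + dG Y X Z - dG Z X Y) / 2"

definition is_levi_civita where
  "is_levi_civita \<Gamma> \<longleftrightarrow> bilinear \<Gamma> \<and> (\<forall>X Y. \<Gamma> X Y = \<Gamma> Y X) \<and>
     (\<forall>X Y Z. dG X Y Z = G x (\<Gamma> X Y) Z + G x Y (\<Gamma> X Z))"

lemma is_levi_civita_koszul:
  assumes "is_levi_civita \<Gamma>"
  shows "G x (\<Gamma> X Y) Z = koszul X Y Z"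
proof -
  have s: "\<Gamma> X Y = \<Gamma> Y X" and m: "dG X Y Z = G x (\<Gamma> X Y) Z + G x Y (\<Gamma> X Z)" for X Y Z
    using assms unfolding is_levi_civita_def by blast+
  show ?thesis
    unfolding koszul_def m s[of Y X] s[of Z X] s[of Z Y]
    using sym[of "\<Gamma> X Z" Y] by simp
qed

lemma linear_koszul: "linear (\<lambda>X. koszul X Y Z)" "linear (\<lambda>Y. koszul X Y Z)" "linear (koszul X Y)"
  using linear_dG by (auto simp: koszul_def linear_iff field_simps)

lemma ex_levi_civita: "\<exists>\<Gamma>. is_levi_civita \<Gamma>"
proof -
  define \<Gamma> where "\<Gamma> X Y = (\<Sum>e\<in>onb. koszul X Y e *\<^sub>R e)" for X Y
  have k: "G x (\<Gamma> X Y) Z = koszul X Y Z" for X Y Z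
    using orthonormal_contract[OF onb linear_koszul(3), of Z X Y]
    by (simp add: \<Gamma>_def h_sum_left sym[of Z] mult.commute)
  have "\<Gamma> X Y = \<Gamma> Y X" for X Y
    by (rule h_nondegenerate) (simp add: k koszul_def dG_sym[of Z X Y for Z])
  moreover have "dG X Y Z = G x (\<Gamma> X Y) Z + G x Y (\<Gamma> X Z)" for X Y Z
    using dG_sym[of X Y Z] dG_sym[of Y X Z] dG_sym[of Z X Y]
    by (simp add: k sym[of Y] koszul_def field_simps)
  moreover have "bilinear \<Gamma>"
    unfolding bilinear_def using linear_koszul
    by (auto simp: \<Gamma>_def linear_iff scaleR_add_left sum.distrib scaleR_sum_right)
  ultimately show ?thesis unfolding is_levi_civita_def by blast
qed

abbreviation "\<Gamma> \<equiv> levi_civita G x"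

lemma is_levi_civita: "is_levi_civita \<Gamma>"
proof -
  obtain \<Delta> where \<Delta>: "is_levi_civita \<Delta>" using ex_levi_civita by blast
  have "\<Theta> = \<Delta>" if "is_levi_civita \<Theta>" for \<Theta>
    by (intro ext h_nondegenerate) (simp add: is_levi_civita_koszul[OF that] is_levi_civita_koszul[OF \<Delta>])
  then have "is_levi_civita (THE \<Gamma>. is_levi_civita \<Gamma>)"
    by (rule theI[of is_levi_civita, OF \<Delta>])
  then show ?thesis
    unfolding levi_civita_def is_levi_civita_def dG_def .
qed

lemma metric: "dG X Y Z = G x (\<Gamma> X Y) Z + G x Y (\<Gamma> X Z)"
  using is_levi_civita unfolding is_levi_civita_def by blast

lemma \<Gamma>_bilinear: "bilinear \<Gamma>"
  using is_levi_civita unfolding is_levi_civita_def by blast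

end

section \<open>Covariant derivative of an almost complex structure\<close>

locale hermitian_germ = metric_germ S x G for S :: "'b::euclidean_space set" and x G +
  fixes A :: "'b \<Rightarrow> 'b \<Rightarrow> 'b"
  assumes herm: "\<And>y. y \<in> S \<Longrightarrow> hermitian_form (G y) (A y)"
    and diffA: "(\<lambda>y. A y u) differentiable (at x)"
begin

sublocale hermitian_form "G x" "A x" using herm S(2) by blast

definition dA where "dA X Z = frechet_derivative (\<lambda>y. A y Z) (at x) X"

lemma dA: "((\<lambda>y. A y Z) has_derivative (\<lambda>X. dA X Z)) (at x)"
  using diffA unfolding dA_def frechet_derivative_works by simp

lemma linear_A: "y \<in> S \<Longrightarrow> linear (A y)"
  using hermitian_form.lin[OF herm] .

lemma linear_dA: "linear (\<lambda>X. dA X Z)" "linear (dA X)"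
  using has_derivative_linear[OF dA] derivative_family_linear[OF S linear_A dA] by auto

text \<open>The endomorphism \<nabla>_X A applied to the constant field \<open>Z\<close>.\<close>

definition nabla where "nabla X Z = dA X Z + \<Gamma> X (A x Z) - A x (\<Gamma> X Z)"

lemma derivative_omega:
  "((\<lambda>y. G y Y (A y Z)) has_derivative (\<lambda>X. dG X Y (A x Z) + G x Y (dA X Z))) (at x)"
  by (rule has_derivative_linear_family[OF S linear_G(1) dG dA])

lemma nabla_omega_eq: "nabla_omega G A x X Y Z = G x Y (nabla X Z)"
  unfolding nabla_omega_def Let_def frechet_derivative_at[OF derivative_omega, symmetric]
  by (simp add: metric nabla_def)

text \<open>Differentiating A^2 = -1 at \<open>x\<close>; the connection terms anticommute with
  \<open>A\<close> by themselves.\<close>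

lemma nabla_A: "nabla X (A x Z) = - A x (nabla X Z)"
proof -
  have "((\<lambda>y. A y (A y Z)) has_derivative (\<lambda>X. dA X (A x Z) + A x (dA X Z))) (at x)"
    by (rule has_derivative_linear_family[OF S linear_A dA dA])
  then have "((\<lambda>y. - Z) has_derivative (\<lambda>X. dA X (A x Z) + A x (dA X Z))) (at x)"
    by (rule has_derivative_transform_within_open[OF _ S]) (simp add: hermitian_form.sq[OF herm])
  from has_derivative_unique[OF this has_derivative_const]
  have "dA X (A x Z) + A x (dA X Z) = 0" by metis
  then have "dA X (A x Z) = - A x (dA X Z)" by (simp add: eq_neg_iff_add_eq_0)
  then show ?thesis
    using bilinear_rneg[OF \<Gamma>_bilinear] by (simp add: nabla_def)
qed

lemma nabla_skew: "G x Y (nabla X Z) = - G x Z (nabla X Y)"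
proof -
  have "((\<lambda>y. G y Y (A y Z) + G y Z (A y Y)) has_derivative
    (\<lambda>X. (dG X Y (A x Z) + G x Y (dA X Z)) + (dG X Z (A x Y) + G x Z (dA X Y)))) (at x)"
    by (intro has_derivative_add derivative_omega)
  then have "((\<lambda>y. 0) has_derivative
    (\<lambda>X. (dG X Y (A x Z) + G x Y (dA X Z)) + (dG X Z (A x Y) + G x Z (dA X Y)))) (at x)"
    by (rule has_derivative_transform_within_open[OF _ S])
      (use hermitian_form.skew[OF herm] inner_form.sym[OF form] in \<open>metis add.right_inverse\<close>)
  from has_derivative_unique[OF this has_derivative_const]
  have "(dG X Y (A x Z) + G x Y (dA X Z)) + (dG X Z (A x Y) + G x Z (dA X Y)) = 0" by metis
  then show ?thesis
    using skew[of "\<Gamma> X Y" Z] skew[of "\<Gamma> X Z" Y] sym[of "\<Gamma> X Z" "A x Y"] sym[of "\<Gamma> X Y" "A x Z"]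
      skew[of Z "\<Gamma> X Y"] skew[of Y "\<Gamma> X Z"]
    by (simp add: metric nabla_def)
qed

lemma nabla_omega_GH_space: "nabla_omega G A x \<in> GH_space (A x)"
proof (rule GH_spaceI)
  have l: "nabla (X + X') Z = nabla X Z + nabla X' Z" "nabla (r *\<^sub>R X) Z = r *\<^sub>R nabla X Z"
    "nabla X (Z + Z') = nabla X Z + nabla X Z'" "nabla X (r *\<^sub>R Z) = r *\<^sub>R nabla X Z" for X X' Z Z' r
    using linear_dA \<Gamma>_bilinear
    by (simp_all add: nabla_def linear_iff bilinear_def scaleR_add_right scaleR_diff_right)
  fix X X' Y Z Z' r
  show "nabla_omega G A x (X + X') Y Z = nabla_omega G A x X Y Z + nabla_omega G A x X' Y Z"
    "nabla_omega G A x (r *\<^sub>R X) Y Z = r * nabla_omega G A x X Y Z"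
    "nabla_omega G A x X Y (Z + Z') = nabla_omega G A x X Y Z + nabla_omega G A x X Y Z'"
    "nabla_omega G A x X Y (r *\<^sub>R Z) = r * nabla_omega G A x X Y Z"
    by (simp_all add: nabla_omega_eq l)
  show "nabla_omega G A x X Y Z = - nabla_omega G A x X Z Y"
    unfolding nabla_omega_eq by (rule nabla_skew)
  show "nabla_omega G A x X (A x Y) (A x Z) = - nabla_omega G A x X Y Z"
    by (simp add: nabla_omega_eq nabla_A orth)
qed

end

text \<open>The Leibniz rule for K = IJ; the minus sign comes from moving \<open>I\<close> to the
  other side of the metric.\<close>

lemma nabla_omega_composition:
  assumes I: "hermitian_germ S x G I" and J: "hermitian_germ S x G J" and K: "hermitian_germ S x G K"
    and IJ: "\<And>y u. y \<in> S \<Longrightarrow> K y u = I y (J y u)"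
  shows "nabla_omega G K x X Y Z = nabla_omega G I x X Y (J x Z) - nabla_omega G J x X (I x Y) Z"
proof -
  interpret I: hermitian_germ S x G I by (rule I)
  interpret J: hermitian_germ S x G J by (rule J)
  interpret K: hermitian_germ S x G K by (rule K)
  have "((\<lambda>y. I y (J y Z)) has_derivative (\<lambda>X. I.dA X (J x Z) + I x (J.dA X Z))) (at x)"
    by (rule has_derivative_linear_family[OF I.S I.linear_A I.dA J.dA])
  then have "((\<lambda>y. K y Z) has_derivative (\<lambda>X. I.dA X (J x Z) + I x (J.dA X Z))) (at x)"
    by (rule has_derivative_transform_within_open[OF _ I.S]) (simp add: IJ)
  from has_derivative_unique[OF K.dA this]
  have "K.dA X Z = I.dA X (J x Z) + I x (J.dA X Z)" by metis
  then have "K.nabla X Z = I.nabla X (J x Z) + I x (J.nabla X Z)"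
    by (simp add: K.nabla_def I.nabla_def J.nabla_def IJ[OF I.S(2)])
  then show ?thesis
    by (simp add: K.nabla_omega_eq I.nabla_omega_eq J.nabla_omega_eq I.skew)
qed

section \<open>Types of almost hyper-Hermitian manifolds\<close>

lemma smooth_on_differentiable: "smooth_on f S \<Longrightarrow> x \<in> S \<Longrightarrow> f differentiable (at x)"
  unfolding smooth_on_def using Ck_on.simps(2)[of 0 f S] by blast

lemma hermitian_germ_chart:
  assumes M: "smooth_manifold M \<A>" and g: "riemannian_metric \<A> g" and A: "endomorphism_field \<A> A"
    and sq: "\<And>y u. y \<in> codom c \<Longrightarrow> A c y (A c y u) = - u"
    and orth: "\<And>y u v. y \<in> codom c \<Longrightarrow> g c y (A c y u) (A c y v) = g c y u v"
    and c: "c \<in> \<A>" and x: "x \<in> codom c"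
  shows "hermitian_germ (codom c) x (g c) (A c)"
proof -
  have form: "inner_form (g c y)" if "y \<in> codom c" for y
    using g c that unfolding riemannian_metric_def inner_form_def by blast
  have "metric_germ (codom c) x (g c)"
  proof (rule metric_germ.intro)
    show "open (codom c)" using M c unfolding smooth_manifold_def is_chart_def by blast
    show "(\<lambda>y. g c y u v) differentiable (at x)" for u v
      using g c x smooth_on_differentiable unfolding riemannian_metric_def by blast
  qed (fact x, fact form)
  moreover have "hermitian_form (g c y) (A c y)" if y: "y \<in> codom c" for y
    using form[OF y] A c y sq orth
    unfolding hermitian_form_def hermitian_form_axioms_def endomorphism_field_def by blast
  moreover have "(\<lambda>y. A c y u) differentiable (at x)" for u
    using A c x smooth_on_differentiable unfolding endomorphism_field_def by blast
  ultimately show ?thesis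
    unfolding hermitian_germ_def hermitian_germ_axioms_def by blast
qed

lemma GH_type_Union:
  "GH_type \<A> g A = (\<Union>c\<in>\<A>. \<Union>x\<in>codom c. {i \<in> {1..4}. \<exists>X Y Z.
     GH_component (g c x) (A c x) i (nabla_omega (g c) (A c) x) X Y Z \<noteq> 0})"
  unfolding GH_type_def by blast

text \<open>A type is a union over charts and points, so everything reduces to the quaternionic
  algebra of a single coordinate tangent space.\<close>

lemma almost_hyper_hermitian_types_compatible:
  fixes \<A> :: "('a, 'b::euclidean_space) chart set"
  assumes "almost_hyper_hermitian M \<A> g I J K" and dim: "DIM('b) > 4"
  shows "compatible_sym (GH_type \<A> g I) (GH_type \<A> g J) (GH_type \<A> g K)"
  unfolding GH_type_Union
proof (intro compatible_sym_Union)
  fix c x assume c: "c \<in> \<A>" and x: "x \<in> codom c"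
  note AHH = assms(1)[unfolded almost_hyper_hermitian_def]
  have M: "smooth_manifold M \<A>" and g: "riemannian_metric \<A> g"
    and endo: "endomorphism_field \<A> I" "endomorphism_field \<A> J" "endomorphism_field \<A> K"
    using AHH by blast+
  have quat: "I c y (I c y u) = - u" "J c y (J c y u) = - u" "K c y u = I c y (J c y u)"
    "K c y u = - J c y (I c y u)" if "y \<in> codom c" for y u
    using AHH c that by blast+
  have orth: "g c y (I c y u) (I c y v) = g c y u v" "g c y (J c y u) (J c y v) = g c y u v"
    "g c y (K c y u) (K c y v) = g c y u v" if "y \<in> codom c" for y u v
    using AHH c that by blast+
  have lin: "linear (I c y)" "linear (J c y)" "linear (K c y)" if "y \<in> codom c" for y
    using endo c that by (simp_all add: endomorphism_field_def)
  have KK: "K c y (K c y u) = - u" if y: "y \<in> codom c" for y u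
  proof -
    have "J c y (K c y u) = I c y u"
      by (simp add: quat(2,4)[OF y] linear_neg[OF lin(2)[OF y]])
    then show ?thesis by (simp add: quat(1)[OF y] quat(3)[OF y, of "K c y u"])
  qed
  note germ = hermitian_germ_chart[OF M g _ _ _ c x]
  interpret I: hermitian_germ "codom c" x "g c" "I c" by (rule germ[OF endo(1) quat(1) orth(1)])
  interpret J: hermitian_germ "codom c" x "g c" "J c" by (rule germ[OF endo(2) quat(2) orth(2)])
  interpret K: hermitian_germ "codom c" x "g c" "K c" by (rule germ[OF endo(3) KK orth(3)])
  interpret quaternionic_form "g c x" "I c x" "J c x" "K c x"
  proof (intro quaternionic_form.intro quaternionic_form_axioms.intro)
    show "J c x (I c x u) = - K c x u" for u using quat(4)[OF x] by simp
  qed (fact I.inner_form_axioms lin[OF x] quat(1,2)[OF x] quat(3)[OF x, symmetric] orth[OF x])+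
  show "compatible_sym
      {i \<in> {1..4}. \<exists>X Y Z. GH_component (g c x) (I c x) i (nabla_omega (g c) (I c) x) X Y Z \<noteq> 0}
      {i \<in> {1..4}. \<exists>X Y Z. GH_component (g c x) (J c x) i (nabla_omega (g c) (J c) x) X Y Z \<noteq> 0}
      {i \<in> {1..4}. \<exists>X Y Z. GH_component (g c x) (K c x) i (nabla_omega (g c) (K c) x) X Y Z \<noteq> 0}"
    using nabla_omega_composition[OF I.hermitian_germ_axioms J.hermitian_germ_axioms
        K.hermitian_germ_axioms quat(3)]
    by (intro types_compatible I.nabla_omega_GH_space J.nabla_omega_GH_space
        K.nabla_omega_GH_space dim)
qed

theorem mainTheorem8:
  fixes n :: nat
    and types :: "nat set multiset set"
  assumes "n \<ge> 3"
    and "DIM('b::euclidean_space) = 4 * n"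
  defines "types \<equiv> {{#GH_type \<A> g I, GH_type \<A> g J, GH_type \<A> g K#}
      | (M :: 'a topology) (\<A> :: ('a, 'b) chart set) g I J K.
        almost_hyper_hermitian M \<A> g I J K}"
  shows "finite types \<and> card types \<le> 167"
proof -
  let ?C = "{{#a, b, c#} | a b c. a \<subseteq> {1..4} \<and> b \<subseteq> {1..4} \<and> c \<subseteq> {1..4} \<and> compatible_sym a b c}"
  have dim: "DIM('b) > 4" using assms(1,2) by simp
  have "GH_type \<A> g A \<subseteq> {1..4}" for \<A> :: "('a, 'b) chart set" and g A
    by (auto simp: GH_type_def)
  then have sub: "types \<subseteq> ?C"
    unfolding types_def using almost_hyper_hermitian_types_compatible[OF _ dim] by blast
  show ?thesis
    using finite_subset[OF sub compatible_multisets(1)]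
      order_trans[OF card_mono[OF compatible_multisets(1) sub] compatible_multisets(2)] ..
qed

end
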